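(* Let the field of scalars be $\mathbb{C}$, and let $X$ be a locally separable non-separable metrizable space. Then the spectrum of the $\mathrm{C}^*$-algebra $C_s(X)$ is homeomorphic to $\lambda X$, and thus is locally compact, countably compact and non-normal.
   Context: All spaces are Hausdorff. $C_b(X)$ is the set of all continuous bounded functions $X\to\mathbb{C}$ with pointwise operations, complex conjugation as involution, and the supremum norm. For $f\in C_b(X)$, $\mathrm{Coz}(f)=\{x\in X: f(x)\neq 0\}$ and $\mathrm{supp}(f)=\mathrm{cl}_X\,\mathrm{Coz}(f)$. For a metrizable space $X$, $C_s(X)=\{f\in C_b(X):\mathrm{supp}(f)\text{ is separable}\}$, a (not necessarily unital) commutative $\mathrm{C}^*$-algebra with the structure inherited from $C_b(X)$. The spectrum of a commutative $\mathrm{C}^*$-algebra $A$ is the set of all non-zero algebra homomorphisms $\phi:A\to\mathbb{C}$, equipped with the relative weak$^*$ topology as a subset of the dual $A^*$. Let $\beta X$ be the Stone–Čech compactification of $X$ and let $\mathrm{Coz}(X)=\{\mathrm{Coz}(f):f\in C_b(X)\}$. For a metrizable space $X$, the subspace $\lambda X$ of $\beta X$ is $$\lambda X=\bigcup\{\mathrm{int}_{\beta X}\,\mathrm{cl}_{\beta X}C: C\in\mathrm{Coz}(X)\text{ is separable}\}.$$ A space is locally separable if each of its points has a separable open neighborhood. A space is countably compact if every countable open cover has a finite subcover. *)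

theory Defs
  imports "HOL-Analysis.Analysis"
begin

section \<open>Local separability and countable compactness\<close>

abbreviation separable_in :: "'a topology \<Rightarrow> 'a set \<Rightarrow> bool" where
  "separable_in X S \<equiv> separable_space (subtopology X S)"

definition locally_separable_space :: "'a topology \<Rightarrow> bool" where
  "locally_separable_space X \<longleftrightarrow>
     (\<forall>x \<in> topspace X. \<exists>U. openin X U \<and> x \<in> U \<and> separable_in X U)"

text \<open>The library's \<open>countably_compact\<close> concerns subsets of type-class spaces only.\<close>

definition countably_compact_space :: "'a topology \<Rightarrow> bool" where
  "countably_compact_space X \<longleftrightarrow>
     (\<forall>\<U>. countable \<U> \<and> (\<forall>U \<in> \<U>. openin X U) \<and> topspace X \<subseteq> \<Union>\<U>
        \<longrightarrow> (\<exists>\<F>. finite \<F> \<and> \<F> \<subseteq> \<U> \<and> topspace X \<subseteq> \<Union>\<F>))"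


section \<open>Algebras of bounded continuous functions\<close>

text \<open>Functions on \<open>X\<close> are represented by HOL functions that are extensional on
  \<open>topspace X\<close>, as in the library's metric space \<open>cfunspace\<close>. Hence the pointwise
  operations have to be restricted to \<open>topspace X\<close>.\<close>

definition Cb :: "'a topology \<Rightarrow> ('a \<Rightarrow> complex) set" where
  "Cb X = mspace (cfunspace X euclidean_metric)"

lemma Cb_iff:
  "f \<in> Cb X \<longleftrightarrow>
     f \<in> extensional (topspace X) \<and> continuous_map X euclidean f \<and> bounded (f ` topspace X)"
  by (auto simp: Cb_def)

definition fun_add :: "'a topology \<Rightarrow> ('a \<Rightarrow> complex) \<Rightarrow> ('a \<Rightarrow> complex) \<Rightarrow> 'a \<Rightarrow> complex" where
  "fun_add X f g = (\<lambda>x \<in> topspace X. f x + g x)"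

definition fun_scale :: "'a topology \<Rightarrow> complex \<Rightarrow> ('a \<Rightarrow> complex) \<Rightarrow> 'a \<Rightarrow> complex" where
  "fun_scale X c f = (\<lambda>x \<in> topspace X. c * f x)"

definition fun_mult :: "'a topology \<Rightarrow> ('a \<Rightarrow> complex) \<Rightarrow> ('a \<Rightarrow> complex) \<Rightarrow> 'a \<Rightarrow> complex" where
  "fun_mult X f g = (\<lambda>x \<in> topspace X. f x * g x)"

text \<open>Only meaningful if \<open>topspace X\<close> is nonempty.\<close>

definition sup_norm :: "'a topology \<Rightarrow> ('a \<Rightarrow> complex) \<Rightarrow> real" where
  "sup_norm X f = (SUP x \<in> topspace X. cmod (f x))"

definition coz :: "'a topology \<Rightarrow> ('a \<Rightarrow> complex) \<Rightarrow> 'a set" where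
  "coz X f = {x \<in> topspace X. f x \<noteq> 0}"

definition supp :: "'a topology \<Rightarrow> ('a \<Rightarrow> complex) \<Rightarrow> 'a set" where
  "supp X f = X closure_of (coz X f)"

definition Coz :: "'a topology \<Rightarrow> 'a set set" where
  "Coz X = coz X ` Cb X"

definition Cs :: "'a topology \<Rightarrow> ('a \<Rightarrow> complex) set" where
  "Cs X = {f \<in> Cb X. separable_in X (supp X f)}"


section \<open>The spectrum\<close>

text \<open>In this section \<open>A\<close> stands for a subalgebra of \<open>Cb X\<close>. Functionals on \<open>A\<close> are
  represented by HOL functions that are extensional on \<open>A\<close>.\<close>

definition linear_functional ::
    "'a topology \<Rightarrow> ('a \<Rightarrow> complex) set \<Rightarrow> (('a \<Rightarrow> complex) \<Rightarrow> complex) \<Rightarrow> bool" where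
  "linear_functional X A \<phi> \<longleftrightarrow>
     \<phi> \<in> extensional A \<and>
     (\<forall>f \<in> A. \<forall>g \<in> A. \<phi> (fun_add X f g) = \<phi> f + \<phi> g) \<and>
     (\<forall>c. \<forall>f \<in> A. \<phi> (fun_scale X c f) = c * \<phi> f)"

definition dual_space ::
    "'a topology \<Rightarrow> ('a \<Rightarrow> complex) set \<Rightarrow> (('a \<Rightarrow> complex) \<Rightarrow> complex) set" where
  "dual_space X A =
     {\<phi>. linear_functional X A \<phi> \<and> (\<exists>B. \<forall>f \<in> A. cmod (\<phi> f) \<le> B * sup_norm X f)}"

text \<open>The weak* topology is the topology of pointwise convergence on \<open>A\<close>.\<close>

definition weak_star_topology ::
    "'a topology \<Rightarrow> ('a \<Rightarrow> complex) set \<Rightarrow> (('a \<Rightarrow> complex) \<Rightarrow> complex) topology" where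
  "weak_star_topology X A =
     subtopology (product_topology (\<lambda>_. euclidean) A) (dual_space X A)"

definition characters ::
    "'a topology \<Rightarrow> ('a \<Rightarrow> complex) set \<Rightarrow> (('a \<Rightarrow> complex) \<Rightarrow> complex) set" where
  "characters X A =
     {\<phi>. linear_functional X A \<phi> \<and>
         (\<forall>f \<in> A. \<forall>g \<in> A. \<phi> (fun_mult X f g) = \<phi> f * \<phi> g) \<and>
         (\<exists>f \<in> A. \<phi> f \<noteq> 0)}"

definition spectrum ::
    "'a topology \<Rightarrow> ('a \<Rightarrow> complex) set \<Rightarrow> (('a \<Rightarrow> complex) \<Rightarrow> complex) topology" where
  "spectrum X A = subtopology (weak_star_topology X A) (characters X A)"

text \<open>Characters of \<open>Cs X\<close> are automatically bounded, so the passage to the subspace loses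
  none of them.\<close>

lemma Cs_cong_coz:
  assumes "f \<in> Cs X" "g \<in> Cb X" "coz X g = coz X f"
  shows "g \<in> Cs X"
  using assms by (simp add: Cs_def supp_def)

lemma characters_Cs_contractive:
  assumes ne: "topspace X \<noteq> {}" and \<phi>: "\<phi> \<in> characters X (Cs X)" and f: "f \<in> Cs X"
  shows "cmod (\<phi> f) \<le> sup_norm X f"
proof (rule ccontr)
  assume "\<not> cmod (\<phi> f) \<le> sup_norm X f"
  then have less: "sup_norm X f < cmod (\<phi> f)" by simp
  define c where "c = \<phi> f"
  define r where "r = sup_norm X f / cmod c"
  have fb: "continuous_map X euclidean f" "bounded (f ` topspace X)"
    using f by (auto simp: Cs_def Cb_iff)
  have bdd: "bdd_above ((\<lambda>x. cmod (f x)) ` topspace X)"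
    using fb(2) by (auto simp: bounded_iff bdd_above_def)
  have le: "cmod (f x) \<le> sup_norm X f" if "x \<in> topspace X" for x
    unfolding sup_norm_def using bdd that by (rule cSUP_upper2) simp
  have "0 \<le> sup_norm X f"
    using ne le by (meson ex_in_conv norm_ge_zero order_trans)
  with less have c: "c \<noteq> 0" and r: "0 \<le> r" "r < 1"
    by (auto simp: c_def r_def divide_simps)
  define g where "g = fun_scale X (1 / c) f"
  define h where "h = (\<lambda>x \<in> topspace X. g x / (1 - g x))"
  have gx: "g x = f x / c" if "x \<in> topspace X" for x
    using that by (simp add: g_def fun_scale_def)
  have gr: "cmod (g x) \<le> r" if "x \<in> topspace X" for x
    using le[OF that] c by (simp add: gx that norm_divide r_def divide_right_mono)
  have g1: "1 - r \<le> cmod (1 - g x)" "1 - g x \<noteq> 0" if "x \<in> topspace X" for x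
  proof -
    show *: "1 - r \<le> cmod (1 - g x)"
      using gr[OF that] norm_triangle_ineq2[of 1 "g x"] by simp
    show "1 - g x \<noteq> 0" using * r by auto
  qed
  have contg: "continuous_map X euclidean g"
  proof (rule continuous_map_eq)
    have "continuous_map euclidean euclidean (\<lambda>z::complex. (1 / c) * z)"
      using c by (simp, intro continuous_intros) auto
    from continuous_map_compose[OF fb(1) this]
    show "continuous_map X euclidean (\<lambda>x. (1 / c) * f x)"
      by (simp add: o_def)
  qed (use gx in auto)
  have contg': "continuous_map X (top_of_set (- {1})) g"
    using contg g1(2) by (force simp: continuous_map_in_subtopology)
  have conth: "continuous_map X euclidean h"
  proof (rule continuous_map_eq)
    have "continuous_map (top_of_set (- {1})) euclidean (\<lambda>z::complex. z / (1 - z))"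
      by (simp, intro continuous_intros) auto
    from continuous_map_compose[OF contg' this]
    show "continuous_map X euclidean (\<lambda>x. g x / (1 - g x))"
      by (simp add: o_def)
  qed (auto simp: h_def)
  have gC: "g \<in> Cs X"
  proof (rule Cs_cong_coz[OF f])
    show "g \<in> Cb X"
      using contg gr by (auto simp: Cb_iff g_def fun_scale_def bounded_iff)
    show "coz X g = coz X f"
      using c by (auto simp: coz_def gx)
  qed
  have hb: "cmod (h x) \<le> r / (1 - r)" if "x \<in> topspace X" for x
    using that gr[OF that] g1(1)[OF that] r
    by (simp add: h_def norm_divide) (rule frac_le, auto)
  have hC: "h \<in> Cs X"
  proof (rule Cs_cong_coz[OF gC])
    show "h \<in> Cb X"
      using conth hb by (auto simp: Cb_iff bounded_iff h_def)
    show "coz X h = coz X g"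
      using g1(2) by (auto simp: coz_def h_def)
  qed
  have ghC: "fun_mult X g h \<in> Cs X"
  proof (rule Cs_cong_coz[OF gC])
    have "cmod (g x * h x) \<le> r * (r / (1 - r))" if "x \<in> topspace X" for x
      unfolding norm_mult using gr[OF that] hb[OF that] r by (intro mult_mono) auto
    moreover have "continuous_map X euclidean (\<lambda>x \<in> topspace X. g x * h x)"
    proof (rule continuous_map_eq)
      have "continuous_map (top_of_set (- {1})) euclidean (\<lambda>z::complex. z * (z / (1 - z)))"
        by (simp, intro continuous_intros) auto
      from continuous_map_compose[OF contg' this]
      show "continuous_map X euclidean (\<lambda>x. g x * (g x / (1 - g x)))"
        by (simp add: o_def)
    qed (auto simp: h_def)
    ultimately show "fun_mult X g h \<in> Cb X"
      by (auto simp: Cb_iff bounded_iff fun_mult_def)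
    show "coz X (fun_mult X g h) = coz X g"
      using g1(2) by (auto simp: coz_def h_def fun_mult_def)
  qed
  have h_eq: "h = fun_add X (fun_mult X g h) g"
  proof
    fix x show "h x = fun_add X (fun_mult X g h) g x"
      using g1(2)[of x] by (auto simp: h_def fun_add_def fun_mult_def field_simps)
  qed
  have "\<phi> g = (1 / c) * \<phi> f"
    using \<phi> f by (auto simp: characters_def linear_functional_def g_def)
  then have "\<phi> g = 1" using c by (simp add: c_def)
  moreover have "\<phi> h = \<phi> (fun_mult X g h) + \<phi> g"
    using \<phi> ghC gC by (subst h_eq) (auto simp: characters_def linear_functional_def)
  moreover have "\<phi> (fun_mult X g h) = \<phi> g * \<phi> h"
    using \<phi> gC hC by (auto simp: characters_def)
  ultimately show False by simp
qed

lemma topspace_spectrum_Cs: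
  assumes "topspace X \<noteq> {}"
  shows "topspace (spectrum X (Cs X)) = characters X (Cs X)"
proof -
  have "\<phi> \<in> dual_space X (Cs X)" if "\<phi> \<in> characters X (Cs X)" for \<phi>
    using that characters_Cs_contractive[OF assms that]
    by (auto simp: dual_space_def characters_def intro!: exI[of _ 1])
  then show ?thesis
    by (auto simp: spectrum_def weak_star_topology_def dual_space_def linear_functional_def
        topspace_subtopology PiE_def)
qed


section \<open>The Stone-Cech compactification and the subspace lambda\<close>

text \<open>The Stone-Cech compactification of \<open>X\<close> is realised as the closure of the image of \<open>X\<close>
  under the evaluation map into the cube indexed by all continuous functions
  \<open>X \<rightarrow> [0,1]\<close>. Subsets of \<open>X\<close> are regarded as subsets of the compactification through
  that map.\<close>

definition unit_functions :: "'a topology \<Rightarrow> ('a \<Rightarrow> real) set" where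
  "unit_functions X = {f \<in> topspace X \<rightarrow>\<^sub>E {0..1}. continuous_map X euclideanreal f}"

definition cube :: "'a topology \<Rightarrow> (('a \<Rightarrow> real) \<Rightarrow> real) topology" where
  "cube X = product_topology (\<lambda>_. top_of_set {0..1}) (unit_functions X)"

definition evaluation :: "'a topology \<Rightarrow> 'a \<Rightarrow> ('a \<Rightarrow> real) \<Rightarrow> real" where
  "evaluation X x = (\<lambda>f \<in> unit_functions X. f x)"

definition stone_cech :: "'a topology \<Rightarrow> (('a \<Rightarrow> real) \<Rightarrow> real) topology" where
  "stone_cech X = subtopology (cube X) (cube X closure_of (evaluation X ` topspace X))"

definition lambda_set :: "'a topology \<Rightarrow> (('a \<Rightarrow> real) \<Rightarrow> real) set" where
  "lambda_set X =
     \<Union> {stone_cech X interior_of (stone_cech X closure_of (evaluation X ` C)) | C.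
          C \<in> Coz X \<and> separable_in X C}"

definition lambda_space :: "'a topology \<Rightarrow> (('a \<Rightarrow> real) \<Rightarrow> real) topology" where
  "lambda_space X = subtopology (stone_cech X) (lambda_set X)"

text \<open>For completely regular Hausdorff \<open>X\<close>, the space \<open>stone_cech X\<close> is a Hausdorff
  compactification of \<open>X\<close> to which all continuous functions \<open>X \<rightarrow> [0,1]\<close> extend.\<close>

lemma compact_space_stone_cech: "compact_space (stone_cech X)"
proof -
  have "compact_space (cube X)"
    unfolding cube_def
    using compact_space_product_topology compact_space_subtopology compactin_euclidean_iff by blast
  then show ?thesis
    unfolding stone_cech_def
    by (intro compact_space_subtopology closedin_compact_space) simp_all
qed

lemma Hausdorff_space_stone_cech: "Hausdorff_space (stone_cech X)"
  unfolding stone_cech_def cube_def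
  by (intro Hausdorff_space_subtopology)
     (auto simp: Hausdorff_space_product_topology Hausdorff_space_subtopology)

lemma evaluation_in_cube: "evaluation X ` topspace X \<subseteq> topspace (cube X)"
proof -
  have "f x \<in> {0..1}" if "f \<in> unit_functions X" "x \<in> topspace X" for f x
    using that by (auto simp: unit_functions_def PiE_def Pi_def)
  then show ?thesis
    by (auto simp: evaluation_def cube_def)
qed

lemma dense_stone_cech: "stone_cech X closure_of (evaluation X ` topspace X) = topspace (stone_cech X)"
  using closure_of_subset[OF evaluation_in_cube, of X]
  by (auto simp: stone_cech_def closure_of_subtopology closure_of_subset_topspace
      Int_absorb1 topspace_subtopology dest: in_closure_of[THEN iffD1])

lemma embedding_map_stone_cech:
  assumes "completely_regular_space X" "Hausdorff_space X"
  shows "embedding_map X (stone_cech X) (evaluation X)"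
proof -
  have "unit_functions X = mspace (submetric (cfunspace X euclidean_metric) {f. f \<in> topspace X \<rightarrow> {0..1}})"
    by (auto simp: unit_functions_def PiE_def intro: bounded_subset[OF bounded_closed_interval])
  then have "embedding_map X (cube X) (evaluation X)"
    using completely_regular_space_cube_embedding_explicit[OF assms]
    by (simp add: cube_def evaluation_def[abs_def])
  then show ?thesis
    using closure_of_subset[OF evaluation_in_cube, of X]
    by (simp add: stone_cech_def embedding_map_def subtopology_subtopology Int_absorb1)
qed

lemma extension_stone_cech:
  assumes "f \<in> unit_functions X"
  shows "\<exists>F. continuous_map (stone_cech X) (top_of_set {0..1}) F \<and> (\<forall>x \<in> topspace X. F (evaluation X x) = f x)"
proof (intro exI conjI)
  show "continuous_map (stone_cech X) (top_of_set {0..1}) (\<lambda>p. p f)"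
    unfolding stone_cech_def cube_def
    by (intro continuous_map_from_subtopology continuous_map_product_projection assms)
qed (simp add: evaluation_def assms)

end

theory Submission
  imports Defs "HOL-Library.Countable_Set_Type"
begin

text \<open>Every character of \<open>Cs X\<close> is a point evaluation. Bounded continuous functions on \<open>X\<close> extend
  uniquely to the Stone-Cech compactification \<open>\<beta>X\<close>, and a compactness argument shows that a
  character \<open>\<phi>\<close> of \<open>Cs X\<close> has the form \<open>f \<mapsto> f\<^sup>\<beta>(p)\<close> for some \<open>p\<close> in \<open>\<beta>X\<close>
  (\<open>character_is_evaluation\<close>). Evaluation at \<open>p\<close> is nonzero on \<open>Cs X\<close> exactly for \<open>p\<close> in
  \<open>\<lambda>X\<close> (\<open>lambda_set_iff\<close>), and the extensions of functions in \<open>Cs X\<close> separate points of \<open>\<lambda>X\<close> from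
  closed sets. Hence the spectrum is homeomorphic to \<open>\<lambda>X\<close>
  (\<open>homeomorphic_map_point_character\<close>), and the other assertions are statements about \<open>\<lambda>X\<close>.

  As an open subset of a compact Hausdorff space, \<open>\<lambda>X\<close> is locally compact. In a locally separable
  metrizable space the closure of a separable set \<open>S\<close> has a separable open neighbourhood; so the
  closure of \<open>S\<close> in \<open>\<beta>X\<close> is a compact subset of \<open>\<lambda>X\<close>. Each countable subset of \<open>\<lambda>X\<close> lies in one
  of these compact sets, and \<open>\<lambda>X\<close> is countably compact.

  Non-normality needs a combinatorial obstruction. Since \<open>X\<close> is not separable, it contains an
  uncountable set \<open>D\<close> of points with mutual distances bounded away from 0. On \<open>D\<close> there is a
  family of pairs \<open>(P\<^sub>a, Q\<^sub>a)\<close>, \<open>a < \<omega>\<^sub>1\<close>, of disjoint countable sets that cohere modulo finite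
  sets, while no single subset of \<open>D\<close> contains all \<open>P\<^sub>a\<close> and misses all \<open>Q\<^sub>a\<close> modulo finite sets
  (\<open>unseparable_coherent_pairs\<close>). It is derived from the coherent finite-to-one maps that also
  give an Aronszajn tree. The limit points in \<open>\<lambda>X\<close> of the sets \<open>P\<^sub>a\<close> and those of the sets
  \<open>Q\<^sub>a\<close> form two disjoint sets, which are closed by coherence. A continuous function separating them
  would yield a subset of \<open>D\<close> separating all the pairs
  (\<open>not_normal_if_uncountable_strongly_discrete\<close>).\<close>

section \<open>Coherent families of finite-to-one maps\<close>

text \<open>These are the maps from which coherent Aronszajn trees are built: each \<open>e a\<close> is finite-to-one on the initial
segment below \<open>a\<close>, and for \<open>b\<close> below \<open>a\<close> the maps \<open>e a\<close> and \<open>e b\<close> differ at finitely many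
points of the segment below \<open>b\<close>. The recursion treats successors and limits alike. If
\<open>g a 0, g a 1, \<dots>\<close> enumerates the proper predecessors of \<open>a\<close>, then the value of \<open>e a\<close> at
\<open>x < a\<close> is copied from the first \<open>e (g a n)\<close> that is concerned with \<open>x\<close>, but raised to at
least \<open>n\<close>. Raising makes \<open>e a\<close> finite-to-one, since values up to \<open>k\<close> come only from the first
\<open>k + 1\<close> segments; and it changes \<open>e (g a n)\<close> only where that map is below \<open>n\<close>, hence at
finitely many points.\<close>

lemma coherent_finite_to_one_maps:
  fixes r :: "'i rel"
  assumes wo: "Well_order r" and cnt: "\<And>a. a \<in> Field r \<Longrightarrow> countable (underS r a)"
  obtains e :: "'i \<Rightarrow> 'i \<Rightarrow> nat"
  where "\<And>a k. finite {x \<in> under r a. e a x \<le> k}"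
    and "\<And>a b. (b, a) \<in> r \<Longrightarrow> finite {x \<in> under r b. e a x \<noteq> e b x}"
proof -
  have wf: "wf (r - Id)" and lin: "Linear_order r"
    using wo by (auto simp: well_order_on_def)
  have trans: "(a, c) \<in> r" if "(a, b) \<in> r" "(b, c) \<in> r" for a b c
    using lin that by (auto simp: order_on_defs dest: transD)
  have antisym: "a = b" if "(a, b) \<in> r" "(b, a) \<in> r" for a b
    using lin that by (auto simp: order_on_defs dest: antisymD)
  have total: "(a, b) \<in> r \<or> (b, a) \<in> r" if "a \<in> Field r" "b \<in> Field r" for a b
    using lin that wo_rel.TOTALS[of r] wo by (auto simp: wo_rel_def)
  have fld: "a \<in> Field r" "b \<in> Field r" if "(a, b) \<in> r" for a b
    using that by (auto simp: Field_def)
  define g where "g a = from_nat_into (underS r a)" for a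
  define step where "step f a x = (if x = a then 0
      else let n = LEAST n. (x, g a n) \<in> r in max (f (g a n) x) n)"
    for f :: "'i \<Rightarrow> 'i \<Rightarrow> nat" and a x
  define e where "e = wfrec (r - Id) step"
  have g_less: "(g a n, a) \<in> r" "g a n \<noteq> a" if "underS r a \<noteq> {}" for a n
    using from_nat_into[OF that, of n] by (auto simp: g_def underS_def)
  have g_surj: "\<exists>n. g a n = b" if "(b, a) \<in> r" "b \<noteq> a" for a b
    using from_nat_into_surj[OF cnt, of a b] that fld unfolding g_def underS_def by blast
  have e_eq: "e a x = max (e (g a (LEAST n. (x, g a n) \<in> r)) x) (LEAST n. (x, g a n) \<in> r)"
    if "(x, a) \<in> r" "x \<noteq> a" for a x
  proof -
    have "underS r a \<noteq> {}"
      using that by (auto simp: underS_def)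
    then have "(g a n, a) \<in> r - Id" for n
      using g_less[of a n] by auto
    then show ?thesis
      using that wfrec[OF wf, of step a] by (simp add: e_def step_def Let_def cut_def)
  qed
  have below: "\<exists>n. (x, g a n) \<in> r \<and> n = (LEAST n. (x, g a n) \<in> r) \<and> n \<le> k \<and> (g a n, a) \<in> r - Id
      \<and> e a x = max (e (g a n) x) n"
    if "(x, g a k) \<in> r" "(g a k, a) \<in> r" "g a k \<noteq> a" for a x k
  proof -
    have x: "(x, a) \<in> r" "x \<noteq> a"
      using that trans antisym by blast+
    then have "underS r a \<noteq> {}"
      by (auto simp: underS_def)
    then show ?thesis
      using e_eq[OF x] LeastI[of "\<lambda>n. (x, g a n) \<in> r" k] that
        Least_le[of "\<lambda>n. (x, g a n) \<in> r" k] g_less[of a] by auto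
  qed
  have refl: "(a, a) \<in> r" if "a \<in> Field r" for a
    using total that by blast
  have fin: "finite {x \<in> under r a. e a x \<le> k}" for a k
    using wf
  proof (induction a rule: wf_induct_rule)
    case (less a)
    have "{x \<in> under r a. e a x \<le> k}
        \<subseteq> {a} \<union> (\<Union>n\<in>{n. n \<le> k \<and> (g a n, a) \<in> r - Id}. {x \<in> under r (g a n). e (g a n) x \<le> k})"
    proof clarify
      fix x assume x: "x \<in> under r a" "e a x \<le> k"
        "x \<notin> (\<Union>n\<in>{n. n \<le> k \<and> (g a n, a) \<in> r - Id}. {x \<in> under r (g a n). e (g a n) x \<le> k})"
      show "x = a"
      proof (rule ccontr)
        assume ne: "x \<noteq> a"
        then obtain m where "g a m = x" using g_surj[of x a] x by (auto simp: under_def)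
        then obtain n where "(x, g a n) \<in> r" "(g a n, a) \<in> r - Id" "e a x = max (e (g a n) x) n"
          using below[of x a m] ne x refl fld by (auto simp: under_def)
        then show False using x by (auto simp: under_def)
      qed
    qed
    moreover have "finite \<dots>"
      using less.IH by (intro finite_UnI finite_UN_I) auto
    ultimately show ?case by (rule finite_subset)
  qed
  have coh: "\<forall>b. (b, a) \<in> r \<longrightarrow> finite {x \<in> under r b. e a x \<noteq> e b x}" for a
    using wf
  proof (induction a rule: wf_induct_rule)
    case (less a)
    show ?case
    proof (intro allI impI)
      fix b assume ba: "(b, a) \<in> r"
      show "finite {x \<in> under r b. e a x \<noteq> e b x}"
      proof (cases "b = a")
        case False
        then obtain k where k: "g a k = b" using g_surj ba by blast
        let ?I = "{n. n \<le> k \<and> (g a n, a) \<in> r - Id}"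
        let ?F = "\<lambda>n. {x \<in> under r (g a n) \<inter> under r b. e (g a n) x \<noteq> e b x}"
        let ?G = "\<lambda>n. {x \<in> under r (g a n). e (g a n) x \<le> n}"
        have "{x \<in> under r b. e a x \<noteq> e b x} \<subseteq> (\<Union>n\<in>?I. ?F n \<union> ?G n)"
        proof
          fix x assume x: "x \<in> {x \<in> under r b. e a x \<noteq> e b x}"
          then obtain n where n: "(x, g a n) \<in> r" "n \<le> k" "(g a n, a) \<in> r - Id"
              "e a x = max (e (g a n) x) n"
            using below[of x a k] k ba False by (auto simp: under_def)
          then have "x \<in> ?F n \<union> ?G n"
            using x by (auto simp: under_def max_def split: if_splits)
          then show "x \<in> (\<Union>n\<in>?I. ?F n \<union> ?G n)" using n by blast
        qed
        moreover have "finite (?F n)" if "n \<in> ?I" for n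
        proof (cases "(g a n, b) \<in> r")
          case True
          have "?F n \<subseteq> {x \<in> under r (g a n). e b x \<noteq> e (g a n) x}" by auto
          then show ?thesis
            using less.IH[of b] ba False True by (auto intro: finite_subset)
        next
          case F: False
          then have "(b, g a n) \<in> r" using total that ba fld by blast
          moreover have "?F n \<subseteq> {x \<in> under r b. e (g a n) x \<noteq> e b x}" by auto
          ultimately show ?thesis
            using less.IH[of "g a n"] that by (auto intro: finite_subset)
        qed
        ultimately show ?thesis
          using fin by (elim finite_subset) (intro finite_UN_I finite_UnI, auto)
      qed simp
    qed
  qed
  show thesis using that fin coh by blast
qed

text \<open>The index set is \<open>\<omega>\<^sub>1\<close>, realised as the field of the successor cardinal of \<open>\<aleph>\<^sub>0\<close>, and
\<open>\<omega>\<^sub>1 \<times> \<nat>\<close> is embedded into \<open>D\<close> by an injection \<open>h\<close>. The sets \<open>P a\<close> and \<open>Q a\<close> are the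
regions on and under, and above, the graph of a finite-to-one map \<open>e a\<close>, over the segment up to
\<open>a\<close>. A countable \<open>C\<close> meets only columns up to some \<open>a\<close>, and there coherence of the maps
makes all other pairs agree with the pair of \<open>a\<close> up to finite sets. If a single set \<open>S\<close>
separated all the pairs modulo finite sets, the heights of the columns of \<open>S\<close> would define a
function \<open>E\<close> on \<open>\<omega>\<^sub>1\<close> that agrees with each \<open>e a\<close> up to finitely many points. Some value
of \<open>E\<close> is taken uncountably often, so infinitely often below some \<open>a\<close>, which contradicts
that \<open>e a\<close> is finite-to-one.\<close>

lemma unseparable_coherent_pairs:
  fixes D :: "'a set"
  assumes "uncountable D"
  obtains I :: "nat set set" and P Q :: "nat set \<Rightarrow> 'a set"
  where "\<And>i. i \<in> I \<Longrightarrow> P i \<subseteq> D \<and> Q i \<subseteq> D \<and> P i \<inter> Q i = {} \<and> countable (P i) \<and> countable (Q i)"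
    and "\<And>C. \<lbrakk>countable C; C \<subseteq> D\<rbrakk>
           \<Longrightarrow> \<exists>i \<in> I. \<forall>j \<in> I. finite (P j \<inter> C - P i) \<and> finite (Q j \<inter> C - Q i)"
    and "\<And>S. \<exists>i \<in> I. infinite (P i - S) \<or> infinite (Q i \<inter> S)"
proof -
  include cardinal_syntax
  define r where "r = cardSuc natLeq"
  have card: "Card_order r" and wo: "Well_order r"
    unfolding r_def by (simp_all add: cardSuc_Card_order natLeq_Card_order cardSuc_Well_order)
  have "card_of (underS r a) \<le>o natLeq" if "a \<in> Field r" for a
    using card_of_underS[OF card that] unfolding r_def
    by (simp add: cardSuc_ordLeq_ordLess natLeq_Card_order card_of_Card_order)
  then have cntS: "countable (underS r a)" if "a \<in> Field r" for a
    using that countable_card_le_natLeq by blast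
  have cnt: "countable (under r a)" if "a \<in> Field r" for a
  proof -
    have "under r a \<subseteq> insert a (underS r a)" by (auto simp: under_def underS_def)
    then show ?thesis
      by (rule countable_subset) (simp add: cntS[OF that])
  qed
  have iso: "card_of (Field r) =o r" by (simp add: card card_of_Field_ordIso)
  have unc: "uncountable (Field r)"
  proof
    assume "countable (Field r)"
    then have "card_of (Field r) \<le>o natLeq"
      by (simp add: countable_card_le_natLeq)
    then have "r \<le>o natLeq"
      by (rule ordIso_ordLeq_trans[OF ordIso_symmetric[OF iso]])
    then show False
      using not_ordLeq_ordLess[of r natLeq] cardSuc_greater[OF natLeq_Card_order] by (simp add: r_def)
  qed
  have "natLeq <o card_of D"
    using assms not_ordLeq_iff_ordLess[OF natLeq_Well_order card_of_Well_order[of D]]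
    by (simp add: countable_card_le_natLeq)
  then have "r \<le>o card_of D"
    unfolding r_def by (simp add: cardSuc_least natLeq_Card_order card_of_Card_order)
  moreover have "card_of (Field r \<times> (UNIV :: nat set)) =o card_of (Field r)"
    using card_of_Times_infinite[of "Field r" "UNIV :: nat set"] uncountable_infinite[OF unc]
      infinite_iff_card_of_nat[of "Field r"] by simp
  ultimately have "card_of (Field r \<times> (UNIV :: nat set)) \<le>o card_of D"
    using ordIso_ordLeq_trans[OF ordIso_transitive[OF _ iso]] by blast
  then obtain h where h: "inj_on h (Field r \<times> (UNIV :: nat set))" "h ` (Field r \<times> UNIV) \<subseteq> D"
    unfolding card_of_ordLeq[symmetric] by blast
  have h_inj: "x = y \<and> m = n" if "h (x, m) = h (y, n)" "x \<in> Field r" "y \<in> Field r" for x y m n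
    using h(1) that by (auto dest: inj_onD)
  have under_Field: "under r a \<subseteq> Field r" for a
    by (simp add: under_Field)
  obtain e :: "nat set \<Rightarrow> nat set \<Rightarrow> nat"
    where fin: "\<And>a k. finite {x \<in> under r a. e a x \<le> k}"
      and coh: "\<And>a b. (b, a) \<in> r \<Longrightarrow> finite {x \<in> under r b. e a x \<noteq> e b x}"
    using coherent_finite_to_one_maps[OF wo cntS] by blast
  have total: "(a, b) \<in> r \<or> (b, a) \<in> r" if "a \<in> Field r" "b \<in> Field r" for a b
    using that wo_rel.TOTALS[of r] wo by (auto simp: wo_rel_def)
  have coh2: "finite {x \<in> under r a \<inter> under r b. e a x \<noteq> e b x}" if "a \<in> Field r" "b \<in> Field r" for a b
    using total[OF that]
  proof
    assume "(a, b) \<in> r"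
    moreover have "{x \<in> under r a \<inter> under r b. e a x \<noteq> e b x} \<subseteq> {x \<in> under r a. e b x \<noteq> e a x}" by auto
    ultimately show ?thesis using coh finite_subset by blast
  next
    assume "(b, a) \<in> r"
    moreover have "{x \<in> under r a \<inter> under r b. e a x \<noteq> e b x} \<subseteq> {x \<in> under r b. e a x \<noteq> e b x}" by auto
    ultimately show ?thesis using coh finite_subset by blast
  qed
  have bounded: "\<exists>a \<in> Field r. B \<subseteq> under r a" if "countable B" "B \<subseteq> Field r" for B
  proof (rule ccontr)
    assume non: "\<not> ?thesis"
    have "Field r \<subseteq> (\<Union>b\<in>B. under r b)"
    proof
      fix a assume a: "a \<in> Field r"
      then obtain b where "b \<in> B" "(b, a) \<notin> r" using non by (auto simp: under_def)
      then have "(a, b) \<in> r" using total a that by blast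
      then show "a \<in> (\<Union>b\<in>B. under r b)" using \<open>b \<in> B\<close> by (auto simp: under_def)
    qed
    moreover have "countable (\<Union>b\<in>B. under r b)"
      using that cnt by (intro countable_UN) auto
    ultimately show False using unc by (metis countable_subset)
  qed
  define P where "P a = h ` {(x, n). x \<in> under r a \<and> n \<le> e a x}" for a
  define Q where "Q a = h ` {(x, n). x \<in> under r a \<and> e a x < n}" for a
  have props: "P a \<subseteq> D \<and> Q a \<subseteq> D \<and> P a \<inter> Q a = {} \<and> countable (P a) \<and> countable (Q a)"
    if "a \<in> Field r" for a
  proof -
    have sub: "{(x, n). x \<in> under r a \<and> n \<le> e a x} \<subseteq> under r a \<times> UNIV"
      "{(x, n). x \<in> under r a \<and> e a x < n} \<subseteq> under r a \<times> UNIV" by auto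
    have c: "countable (under r a \<times> (UNIV :: nat set))" using cnt[OF that] by simp
    have "P a \<inter> Q a = {}"
      using h_inj under_Field[of a] by (force simp: P_def Q_def)
    moreover have "P a \<subseteq> D" "Q a \<subseteq> D"
      using h(2) under_Field by (auto simp: P_def Q_def subset_iff)
    moreover have "countable (P a)" "countable (Q a)"
      using countable_subset[OF sub(1) c] countable_subset[OF sub(2) c] by (simp_all add: P_def Q_def)
    ultimately show ?thesis by blast
  qed
  have absorb: "\<exists>a \<in> Field r. \<forall>b \<in> Field r. finite (P b \<inter> C - P a) \<and> finite (Q b \<inter> C - Q a)"
    if "countable C" for C
  proof -
    define B where "B = {x \<in> Field r. \<exists>n. h (x, n) \<in> C}"
    have "countable (h -` C \<inter> (Field r \<times> UNIV))"
      using countable_image_inj_on[OF countable_subset[OF _ that] inj_on_subset[OF h(1)],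
          of "h -` C \<inter> (Field r \<times> UNIV)"] by blast
    moreover have "B = fst ` (h -` C \<inter> (Field r \<times> UNIV))"
      by (force simp: B_def)
    ultimately have "countable B" by simp
    then obtain a where a: "a \<in> Field r" "B \<subseteq> under r a"
      using bounded[of B] by (auto simp: B_def)
    show ?thesis
    proof (intro bexI[OF _ a(1)] ballI)
      fix b assume b: "b \<in> Field r"
      let ?E = "{x \<in> under r a \<inter> under r b. e a x \<noteq> e b x}"
      let ?R = "h ` (SIGMA x:?E. {..max (e a x) (e b x)})"
      have fR: "finite ?R" using coh2[OF a(1) b] by auto
      have "P b \<inter> C - P a \<subseteq> ?R"
      proof
        fix y assume y: "y \<in> P b \<inter> C - P a"
        then obtain x n where xn: "y = h (x, n)" "x \<in> under r b" "n \<le> e b x" by (auto simp: P_def)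
        moreover have "x \<in> under r a"
          using y xn a under_Field by (auto simp: B_def)
        moreover have "\<not> n \<le> e a x" using y xn \<open>x \<in> under r a\<close> by (auto simp: P_def)
        ultimately show "y \<in> ?R" by auto
      qed
      moreover have "Q b \<inter> C - Q a \<subseteq> ?R"
      proof
        fix y assume y: "y \<in> Q b \<inter> C - Q a"
        then obtain x n where xn: "y = h (x, n)" "x \<in> under r b" "e b x < n" by (auto simp: Q_def)
        moreover have "x \<in> under r a"
          using y xn a under_Field by (auto simp: B_def)
        moreover have "\<not> e a x < n" using y xn \<open>x \<in> under r a\<close> by (auto simp: Q_def)
        ultimately show "y \<in> ?R" by auto
      qed
      ultimately show "finite (P b \<inter> C - P a) \<and> finite (Q b \<inter> C - Q a)"
        using fR by (auto intro: finite_subset)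
    qed
  qed
  have unsep: "\<exists>a \<in> Field r. infinite (P a - S) \<or> infinite (Q a \<inter> S)" for S
  proof (rule ccontr)
    assume "\<not> ?thesis"
    then have S: "finite (P a - S)" "finite (Q a \<inter> S)" if "a \<in> Field r" for a
      using that by blast+
    \<comment> \<open>The element at height 0 always belongs to the lower region, so the search starts at height 1.\<close>
    define E where "E x = (LEAST n. h (x, Suc n) \<notin> S)" for x
    \<comment> \<open>A column on which the two functions differ contains one of the finitely many points that S misplaces.\<close>
    have E: "finite {x \<in> under r a. E x \<noteq> e a x}" if a: "a \<in> Field r" for a
    proof -
      let ?T = "{p \<in> under r a \<times> UNIV. h p \<in> (P a - S) \<union> (Q a \<inter> S)}"
      have "inj_on h ?T"
        using under_Field by (intro inj_on_subset[OF h(1)]) auto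
      moreover have "finite (h ` ?T)"
        using S[OF a] by (rule finite_subset[rotated, OF finite_UnI]) blast
      ultimately have "finite ?T" by (rule finite_imageD[rotated])
      moreover have "{x \<in> under r a. E x \<noteq> e a x} \<subseteq> fst ` ?T"
      proof
        fix x assume x: "x \<in> {x \<in> under r a. E x \<noteq> e a x}"
        show "x \<in> fst ` ?T"
        proof (rule ccontr)
          assume "x \<notin> fst ` ?T"
          then have no: "h (x, n) \<notin> (P a - S) \<union> (Q a \<inter> S)" for n
            using x by force
          have "h (x, Suc n) \<in> S" if "Suc n \<le> e a x" for n
            using no[of "Suc n"] x that by (auto simp: P_def)
          moreover have "h (x, Suc (e a x)) \<notin> S"
            using no[of "Suc (e a x)"] x by (auto simp: Q_def)
          ultimately have "E x = e a x"
            unfolding E_def by (intro Least_equality) (auto simp: not_less_eq_eq[symmetric])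
          then show False using x by simp
        qed
      qed
      ultimately show ?thesis using finite_subset by blast
    qed
    have "\<exists>k. uncountable {x \<in> Field r. E x = k}"
    proof (rule ccontr)
      assume "\<nexists>k. uncountable {x \<in> Field r. E x = k}"
      then have "countable (\<Union>k. {x \<in> Field r. E x = k})" by simp
      moreover have "(\<Union>k. {x \<in> Field r. E x = k}) = Field r" by auto
      ultimately show False using unc by simp
    qed
    then obtain k where "uncountable {x \<in> Field r. E x = k}" by blast
    then obtain V where V: "V \<subseteq> {x \<in> Field r. E x = k}" "countable V" "infinite V"
      using infinite_countable_subset' uncountable_infinite by meson
    then obtain a where a: "a \<in> Field r" "V \<subseteq> under r a" using bounded[of V] by blast
    have sub: "V \<subseteq> {x \<in> under r a. E x \<noteq> e a x} \<union> {x \<in> under r a. e a x \<le> k}"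
    proof
      fix x assume "x \<in> V"
      then have "E x = k" "x \<in> under r a" using V(1) a(2) by auto
      then show "x \<in> {x \<in> under r a. E x \<noteq> e a x} \<union> {x \<in> under r a. e a x \<le> k}"
        by (cases "E x = e a x") simp_all
    qed
    have "finite V"
      by (rule finite_subset[OF sub]) (simp add: E[OF a(1)] fin)
    then show False using V(3) by simp
  qed
  show thesis
    by (rule that[of "Field r" P Q]) (use props absorb unsep in auto)
qed

section \<open>A criterion for non-normality\<close>

lemma countably_compact_space_continuous_image:
  assumes L: "countably_compact_space L" and f: "continuous_map L K f" and onto: "f ` topspace L = topspace K"
  shows "countably_compact_space K"
  unfolding countably_compact_space_def
proof (intro allI impI, elim conjE)
  fix \<U> assume \<U>: "countable \<U>" "\<forall>U \<in> \<U>. openin K U" "topspace K \<subseteq> \<Union>\<U>"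
  define pre where "pre U = {x \<in> topspace L. f x \<in> U}" for U
  have "countable (pre ` \<U>)" "\<forall>V \<in> pre ` \<U>. openin L V"
    using \<U>(1,2) openin_continuous_map_preimage[OF f] by (auto simp: pre_def)
  moreover have "topspace L \<subseteq> \<Union>(pre ` \<U>)"
    using \<U>(3) onto by (fastforce simp: pre_def)
  ultimately obtain \<G> where "finite \<G>" "\<G> \<subseteq> pre ` \<U>" "topspace L \<subseteq> \<Union>\<G>"
    using L unfolding countably_compact_space_def by meson
  then obtain \<F> where \<F>: "finite \<F>" "\<F> \<subseteq> \<U>" "topspace L \<subseteq> \<Union>(pre ` \<F>)"
    by (metis finite_subset_image)
  have "f ` topspace L \<subseteq> \<Union>\<F>"
    using \<F>(3) by (auto simp: pre_def)
  then show "\<exists>\<F>. finite \<F> \<and> \<F> \<subseteq> \<U> \<and> topspace K \<subseteq> \<Union>\<F>"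
    using \<F>(1,2) onto by auto
qed

text \<open>Let \<open>A\<close> be the union of the derived sets of the \<open>P i\<close> and \<open>B\<close> that of the \<open>Q i\<close>, for an
unseparable coherent family of pairs. A point of \<open>L\<close> has a neighbourhood whose trace on \<open>D\<close> is
countable, and finite sets have no limit points; so inside that neighbourhood a single index
accounts for all of \<open>A\<close>. This makes \<open>A\<close> and likewise \<open>B\<close> closed, although both are
uncountable unions. They are disjoint because any two indices are dominated by a third one.
A continuous function separating \<open>A\<close> from \<open>B\<close> would cut \<open>D\<close> at the value \<open>1/2\<close> into two
parts that separate all pairs: infinitely many exceptions would have a limit point, by countable
compactness, on the wrong side of \<open>1/2\<close>.\<close>

lemma not_normal_if_uncountable_strongly_discrete:
  fixes D :: "'a set" and L :: "'b topology"
  assumes haus: "Hausdorff_space L" and cc: "countably_compact_space L"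
    and D: "uncountable D" and j: "inj_on j D" "j ` D \<subseteq> topspace L"
    and trace: "\<And>p. p \<in> topspace L \<Longrightarrow> \<exists>U. openin L U \<and> p \<in> U \<and> countable {d \<in> D. j d \<in> U}"
    and sep: "\<And>P Q. \<lbrakk>P \<subseteq> D; Q \<subseteq> D; P \<inter> Q = {}\<rbrakk>
                \<Longrightarrow> L closure_of (j ` P) \<inter> L closure_of (j ` Q) = {}"
  shows "\<not> normal_space L"
proof
  assume normal: "normal_space L"
  have t1: "t1_space L" using haus Hausdorff_imp_t1_space by blast
  have der_fin: "L derived_set_of S = {}" if "finite S" for S
    using t1 that t1_space_derived_set_of_finite by blast
  \<comment> \<open>Without limit points, the complements of an infinite countable subset with one point put back form a countable open cover without finite subcover.\<close>
  have limpt: "L derived_set_of S \<noteq> {}" if S: "infinite S" "S \<subseteq> topspace L" for S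
  proof
    assume empty: "L derived_set_of S = {}"
    obtain T where T: "T \<subseteq> S" "countable T" "infinite T"
      using infinite_countable_subset' S(1) by blast
    have cl: "closedin L T'" if "T' \<subseteq> T" for T'
      using that T S empty derived_set_of_mono[of T' S L] by (auto simp: closedin_contains_derived_set)
    define \<U> where "\<U> = (\<lambda>t. topspace L - (T - {t})) ` T"
    have "countable \<U>" "\<forall>U \<in> \<U>. openin L U"
      using T(2) cl by (auto simp: \<U>_def)
    moreover have "topspace L \<subseteq> \<Union>\<U>"
      using T(3) unfolding \<U>_def by (auto dest: infinite_imp_nonempty)
    ultimately obtain \<F> where \<F>: "finite \<F>" "\<F> \<subseteq> \<U>" "topspace L \<subseteq> \<Union>\<F>"
      using cc unfolding countably_compact_space_def by meson
    have fin: "finite (U \<inter> T)" if U: "U \<in> \<U>" for U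
    proof -
      obtain t where "U = topspace L - (T - {t})" using U by (auto simp: \<U>_def)
      then have "U \<inter> T \<subseteq> {t}" by auto
      then show ?thesis using finite_subset by blast
    qed
    have "T \<subseteq> (\<Union>U\<in>\<F>. U \<inter> T)" using \<F>(3) T S by blast
    moreover have "finite (\<Union>U\<in>\<F>. U \<inter> T)"
      using \<F> fin by (intro finite_UN_I) auto
    ultimately show False using T(3) finite_subset by blast
  qed
  obtain I :: "nat set set" and P Q
    where PQ: "\<And>i. i \<in> I \<Longrightarrow> P i \<subseteq> D \<and> Q i \<subseteq> D \<and> P i \<inter> Q i = {} \<and> countable (P i) \<and> countable (Q i)"
      and absorb: "\<And>C. \<lbrakk>countable C; C \<subseteq> D\<rbrakk>
           \<Longrightarrow> \<exists>i \<in> I. \<forall>k \<in> I. finite (P k \<inter> C - P i) \<and> finite (Q k \<inter> C - Q i)"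
      and unsep: "\<And>S. \<exists>i \<in> I. infinite (P i - S) \<or> infinite (Q i \<inter> S)"
    by (rule unseparable_coherent_pairs[OF D]) (rule that)
  let ?d = "\<lambda>S. L derived_set_of (j ` S)"
  have almost: "?d S \<subseteq> ?d T" if "finite (S - T)" for S T
  proof -
    have "?d S \<subseteq> ?d (T \<union> (S - T))" by (intro derived_set_of_mono) auto
    also have "\<dots> = ?d T"
      using der_fin[of "j ` (S - T)"] that unfolding image_Un derived_set_of_Un by simp
    finally show ?thesis .
  qed
  have closed: "closedin L (\<Union>i\<in>I. ?d (R i))"
    if R: "\<And>C. \<lbrakk>countable C; C \<subseteq> D\<rbrakk> \<Longrightarrow> \<exists>i \<in> I. \<forall>k \<in> I. finite (R k \<inter> C - R i)"
      "\<And>i. i \<in> I \<Longrightarrow> R i \<subseteq> D" for R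
    unfolding closure_of_subset_eq[symmetric]
  proof (intro conjI subsetI)
    fix p assume p: "p \<in> L closure_of (\<Union>i\<in>I. ?d (R i))"
    then obtain U where U: "openin L U" "p \<in> U" "countable {d \<in> D. j d \<in> U}"
      using trace by (meson in_closure_of)
    obtain i where i: "i \<in> I" "\<forall>k \<in> I. finite (R k \<inter> {d \<in> D. j d \<in> U} - R i)"
      using R(1)[OF U(3)] by auto
    have "U \<inter> (\<Union>k\<in>I. ?d (R k)) \<subseteq> ?d (R i)"
    proof clarify
      fix q k assume q: "q \<in> U" "k \<in> I" "q \<in> ?d (R k)"
      then have "q \<in> L derived_set_of (U \<inter> j ` R k)"
        using openin_Int_derived_set_of_subset[OF U(1)] by blast
      also have "U \<inter> j ` R k = j ` (R k \<inter> {d \<in> D. j d \<in> U})"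
        using R(2)[OF q(2)] by auto
      finally show "q \<in> ?d (R i)" using almost i(2) q(2) by blast
    qed
    moreover have "p \<in> L closure_of (U \<inter> (\<Union>k\<in>I. ?d (R k)))"
      using p U openin_Int_closure_of_subset by fastforce
    ultimately have "p \<in> L closure_of (?d (R i))"
      using closure_of_mono by blast
    moreover have "L closure_of (?d (R i)) = ?d (R i)"
      using closedin_derived_set_of[of L] haus by (simp add: closure_of_eq)
    ultimately show "p \<in> (\<Union>i\<in>I. ?d (R i))"
      using i(1) by auto
  qed (auto dest: derived_set_of_subset_topspace[THEN subsetD])
  define A where "A = (\<Union>i\<in>I. ?d (P i))"
  define B where "B = (\<Union>i\<in>I. ?d (Q i))"
  have "closedin L A" "closedin L B"
    unfolding A_def B_def by (rule closed; use absorb PQ in meson)+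
  moreover have "disjnt A B"
    unfolding disjnt_iff
  proof (intro allI notI, elim conjE)
    fix p assume "p \<in> A" "p \<in> B"
    then obtain i k where ik: "i \<in> I" "k \<in> I" "p \<in> ?d (P i)" "p \<in> ?d (Q k)"
      by (auto simp: A_def B_def)
    obtain l where l: "l \<in> I" "\<forall>m \<in> I. finite (P m \<inter> (P i \<union> Q k) - P l) \<and> finite (Q m \<inter> (P i \<union> Q k) - Q l)"
      using absorb[of "P i \<union> Q k"] PQ ik by auto
    have "finite (P i - P l)" "finite (Q k - Q l)"
      using l(2)[rule_format, OF ik(1)] l(2)[rule_format, OF ik(2)]
      by (simp_all add: Int_absorb2 Un_upper1 Un_upper2)
    then have "p \<in> ?d (P l)" "p \<in> ?d (Q l)" using ik almost by blast+
    then show False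
      using sep[of "P l" "Q l"] PQ[OF l(1)] derived_set_of_subset_closure_of[of L] by blast
  qed
  ultimately obtain f where f: "continuous_map L (top_of_set {0..1::real}) f" "f ` A \<subseteq> {0}" "f ` B \<subseteq> {1}"
    using Urysohn_lemma[OF normal, of A B 0 1] by auto
  then have contf: "continuous_map L euclideanreal f" by (simp add: continuous_map_in_subtopology)
  define S where "S = {d \<in> D. f (j d) < 1/2}"
  have "finite (P i - S)" if i: "i \<in> I" for i
  proof (rule ccontr)
    assume inf: "infinite (P i - S)"
    have "inj_on j (P i - S)" "j ` (P i - S) \<subseteq> topspace L"
      using j PQ[OF i] by (auto intro: inj_on_subset)
    then obtain p where p: "p \<in> ?d (P i - S)"
      using limpt inf by (metis ex_in_conv finite_imageD)
    have "closedin L {x \<in> topspace L. f x \<in> {1/2..}}"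
      using closedin_continuous_map_preimage[OF contf, of "{1/2..}"] by simp
    then have "L closure_of (j ` (P i - S)) \<subseteq> {x \<in> topspace L. f x \<in> {1/2..}}"
      using PQ[OF i] j by (intro closure_of_minimal) (auto simp: S_def)
    then have "f p \<ge> 1/2"
      using p derived_set_of_subset_closure_of by fastforce
    moreover have "p \<in> A"
      using p i derived_set_of_mono[of "j ` (P i - S)" "j ` P i" L] unfolding A_def by blast
    ultimately show False using f(2) by fastforce
  qed
  moreover have "finite (Q i \<inter> S)" if i: "i \<in> I" for i
  proof (rule ccontr)
    assume inf: "infinite (Q i \<inter> S)"
    have "inj_on j (Q i \<inter> S)" "j ` (Q i \<inter> S) \<subseteq> topspace L"
      using j PQ[OF i] by (auto intro: inj_on_subset)
    then obtain p where p: "p \<in> ?d (Q i \<inter> S)"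
      using limpt inf by (metis ex_in_conv finite_imageD)
    have "closedin L {x \<in> topspace L. f x \<in> {..1/2}}"
      using closedin_continuous_map_preimage[OF contf, of "{..1/2}"] by simp
    then have "L closure_of (j ` (Q i \<inter> S)) \<subseteq> {x \<in> topspace L. f x \<in> {..1/2}}"
      using PQ[OF i] j by (intro closure_of_minimal) (auto simp: S_def)
    then have "f p \<le> 1/2"
      using p derived_set_of_subset_closure_of by fastforce
    moreover have "p \<in> B"
      using p i derived_set_of_mono[of "j ` (Q i \<inter> S)" "j ` Q i" L] unfolding B_def by blast
    ultimately show False using f(3) by fastforce
  qed
  ultimately show False using unsep[of S] by blast
qed

section \<open>Separable subsets of metrizable spaces\<close>

lemma separable_in_iff:
  assumes "S \<subseteq> topspace X"
  shows "separable_in X S \<longleftrightarrow> (\<exists>C. countable C \<and> C \<subseteq> S \<and> S \<subseteq> X closure_of C)"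
proof -
  have top: "topspace (subtopology X S) = S"
    using assms by (simp add: topspace_subtopology Int_absorb1)
  have "subtopology X S closure_of C = S \<inter> X closure_of C" if "C \<subseteq> S" for C
    using that by (simp add: closure_of_subtopology Int_absorb1)
  then show ?thesis
    unfolding separable_space_def top by (intro iff_exI conj_cong refl) (simp add: inf.absorb_iff1)
qed

lemma (in Metric_space) closure_of_near:
  assumes "x \<in> mtopology closure_of S" "0 < r"
  obtains y where "y \<in> S" "y \<in> M" "x \<in> M" "d x y < r"
  using assms by (auto simp: metric_closure_of)

text \<open>Subsets of separable metrizable spaces are separable, and so are their closures: for each point
\<open>c\<close> of a countable dense subset and each \<open>n\<close>, one point of \<open>T\<close> within distance
\<open>1/(n+1)\<close> of \<open>c\<close> is selected, if there is one.\<close>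

lemma separable_in_subset_closure:
  assumes X: "metrizable_space X" and S: "separable_in X S" and T: "T \<subseteq> X closure_of S"
  shows "separable_in X T"
proof -
  obtain M d where M: "Metric_space M d" and Xeq: "X = Metric_space.mtopology M d"
    using X unfolding metrizable_space_def by blast
  interpret Metric_space M d by (rule M)
  have S': "separable_in X (topspace X \<inter> S)"
    using S by (metis subtopology_restrict)
  obtain C where C: "countable C" "C \<subseteq> topspace X \<inter> S" "topspace X \<inter> S \<subseteq> X closure_of C"
    using S' separable_in_iff[of "topspace X \<inter> S" X] by auto
  have TC: "T \<subseteq> X closure_of C"
    using T C(3) by (metis closure_of_closure_of closure_of_mono closure_of_restrict subset_trans)
  have TM: "T \<subseteq> M" using T closure_of_subset_topspace[of X S] Xeq by auto
  define t where "t = (\<lambda>(c, n). SOME y. y \<in> T \<and> d c y < inverse (Suc n))"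
  define J where "J = {(c, n). c \<in> C \<and> (\<exists>y\<in>T. d c y < inverse (Suc n))}"
  have t: "t (c, n) \<in> T" "d c (t (c, n)) < inverse (Suc n)" if "(c, n) \<in> J" for c n
    using that someI_ex[of "\<lambda>y. y \<in> T \<and> d c y < inverse (Suc n)"] by (auto simp: t_def J_def)
  have "J \<subseteq> C \<times> UNIV" by (auto simp: J_def)
  then have "countable (t ` J)"
    using C(1) by (meson countable_SIGMA countable_image countable_subset uncountable_def countableI_type)
  moreover have "t ` J \<subseteq> T" using t by auto
  moreover have "T \<subseteq> X closure_of (t ` J)"
  proof
    fix x assume x: "x \<in> T"
    show "x \<in> X closure_of (t ` J)"
      unfolding Xeq metric_closure_of
    proof (intro CollectI conjI allI impI)
      show "x \<in> M" using x TM by auto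
      fix r :: real assume "r > 0"
      then obtain n where n: "inverse (real (Suc n)) < r / 2"
        by (metis half_gt_zero reals_Archimedean)
      have "x \<in> X closure_of C" using TC x by auto
      then obtain c where "c \<in> C" "c \<in> M" "d x c < inverse (Suc n)"
        using closure_of_near[of x C "inverse (Suc n)"] unfolding Xeq by auto
      then have c: "c \<in> C" and dc: "c \<in> M" "d c x < inverse (Suc n)" by (auto simp: commute)
      then have J: "(c, n) \<in> J" using c x by (auto simp: J_def)
      have "d x (t (c, n)) \<le> d x c + d c (t (c, n))"
        using triangle[of x c "t (c, n)"] \<open>x \<in> M\<close> dc t[OF J] TM by auto
      also have "\<dots> < r" using t(2)[OF J] dc(2) n commute[of x c] by linarith
      finally show "\<exists>y\<in>t ` J. y \<in> mball x r"
        using J t(1)[OF J] TM \<open>x \<in> M\<close> by (auto intro!: bexI[of _ "(c, n)"])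
    qed
  qed
  moreover have "T \<subseteq> topspace X"
    using TM Xeq by simp
  ultimately show ?thesis
    unfolding separable_in_iff[OF \<open>T \<subseteq> topspace X\<close>] by blast
qed

lemma separable_in_subset:
  assumes "metrizable_space X" "separable_in X S" "T \<subseteq> S" "T \<subseteq> topspace X"
  shows "separable_in X T"
proof (rule separable_in_subset_closure[OF assms(1,2)])
  show "T \<subseteq> X closure_of S"
    by (rule order_trans[OF closure_of_subset[OF assms(4)] closure_of_mono[OF assms(3)]])
qed

lemma separable_in_Union:
  assumes "countable \<S>" and S: "\<And>S. S \<in> \<S> \<Longrightarrow> S \<subseteq> topspace X \<and> separable_in X S"
  shows "separable_in X (\<Union>\<S>)"
proof -
  have "\<forall>S\<in>\<S>. \<exists>C. countable C \<and> C \<subseteq> S \<and> S \<subseteq> X closure_of C"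
  proof
    fix S assume "S \<in> \<S>"
    then have "S \<subseteq> topspace X" "separable_in X S" using S by auto
    then show "\<exists>C. countable C \<and> C \<subseteq> S \<and> S \<subseteq> X closure_of C"
      by (simp only: separable_in_iff)
  qed
  then obtain c where c: "\<And>S. S \<in> \<S> \<Longrightarrow> countable (c S) \<and> c S \<subseteq> S \<and> S \<subseteq> X closure_of (c S)"
    by metis
  have "countable (\<Union>(c ` \<S>))" "\<Union>(c ` \<S>) \<subseteq> \<Union>\<S>"
    using c assms(1) by auto
  moreover have "S \<subseteq> X closure_of \<Union>(c ` \<S>)" if "S \<in> \<S>" for S
  proof (rule order_trans)
    show "S \<subseteq> X closure_of c S" using c[OF that] by simp
    show "X closure_of c S \<subseteq> X closure_of \<Union>(c ` \<S>)"
      using that by (intro closure_of_mono) auto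
  qed
  then have "\<Union>\<S> \<subseteq> X closure_of \<Union>(c ` \<S>)" by (rule Sup_least)
  moreover have "\<Union>\<S> \<subseteq> topspace X" using S by (intro Sup_least) simp
  ultimately show ?thesis
    unfolding separable_in_iff[OF \<open>\<Union>\<S> \<subseteq> topspace X\<close>] by blast
qed

text \<open>The neighbourhood is the union of those balls of radius \<open>1/(n+1)\<close> around the points of a
countable dense subset of the closure that are separable; by local separability they cover the
closure.\<close>

lemma separable_open_neighbourhood_of_closure:
  assumes X: "metrizable_space X" and loc: "locally_separable_space X" and S: "separable_in X S"
  obtains V where "openin X V" "X closure_of S \<subseteq> V" "separable_in X V"
proof -
  obtain M d where M: "Metric_space M d" and Xeq: "X = Metric_space.mtopology M d"
    using X unfolding metrizable_space_def by blast
  interpret Metric_space M d by (rule M)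
  have "separable_in X (X closure_of S)" 
    using separable_in_subset_closure[OF X S] by blast
  then obtain C where C: "countable C" "C \<subseteq> X closure_of S" "X closure_of S \<subseteq> X closure_of C"
    using separable_in_iff[of "X closure_of S" X] closure_of_subset_topspace by metis
  define \<B> where "\<B> = {B \<in> (\<lambda>(c, n). mball c (inverse (Suc n))) ` (C \<times> UNIV). separable_in X B}"
  have "countable \<B>" unfolding \<B>_def using C(1) by simp
  moreover have B: "openin X B" "separable_in X B" if "B \<in> \<B>" for B
    using that by (auto simp: \<B>_def Xeq)
  ultimately have "separable_in X (\<Union>\<B>)"
    by (intro separable_in_Union) (auto dest: openin_subset)
  moreover have "openin X (\<Union>\<B>)" using B by blast
  moreover have "X closure_of S \<subseteq> \<Union>\<B>"
  proof
    fix x assume x: "x \<in> X closure_of S"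
    then have xM: "x \<in> M" using Xeq by (metis in_closure_of topspace_mtopology)
    obtain U where U: "openin X U" "x \<in> U" "separable_in X U"
      using loc xM Xeq unfolding locally_separable_space_def by auto
    then obtain r where r: "r > 0" "mball x r \<subseteq> U"
      using Xeq by (meson openin_mtopology)
    obtain n where n: "inverse (real (Suc n)) < r / 2"
      using r by (metis half_gt_zero reals_Archimedean)
    have "x \<in> X closure_of C" using C(3) x by auto
    then obtain c where c: "c \<in> C" "c \<in> mball x (inverse (Suc n))"
      using closure_of_near[of x C "inverse (Suc n)"] unfolding Xeq by auto
    have "mball c (inverse (Suc n)) \<subseteq> mball x r"
    proof
      fix y assume y: "y \<in> mball c (inverse (Suc n))"
      then have "d x y \<le> d x c + d c y" using triangle[of x c y] c by auto
      then show "y \<in> mball x r" using y c n by (auto simp del: of_nat_Suc)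
    qed
    then have "separable_in X (mball c (inverse (Suc n)))"
      using separable_in_subset[OF X U(3)] r(2) Xeq by (meson dual_order.trans openin_mball openin_subset)
    moreover have "x \<in> mball c (inverse (Suc n))"
      using c(2) xM by (auto simp: commute)
    ultimately show "x \<in> \<Union>\<B>"
      using c(1) by (auto simp: \<B>_def intro!: bexI[of _ "mball c (inverse (Suc n))"])
  qed
  ultimately show thesis using that by blast
qed

text \<open>For each \<open>n\<close>, a maximal set of points with mutual distances at least \<open>1/(n+1)\<close> exists by Zorn's
lemma. The union of these sets is dense, so one of them is uncountable if \<open>X\<close> is not separable.
All subsets of such a set are closed.\<close>

lemma uncountable_strongly_discrete_subset:
  assumes X: "metrizable_space X" and nsep: "\<not> separable_space X"
  obtains D where "D \<subseteq> topspace X" "uncountable D" "\<And>S. S \<subseteq> D \<Longrightarrow> closedin X S"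
    "\<And>S. separable_in X S \<Longrightarrow> countable (D \<inter> S)"
proof -
  obtain M d where M: "Metric_space M d" and Xeq: "X = Metric_space.mtopology M d"
    using X unfolding metrizable_space_def by blast
  interpret Metric_space M d by (rule M)
  define Sep where "Sep n = {A. A \<subseteq> M \<and> (\<forall>x\<in>A. \<forall>y\<in>A. x \<noteq> y \<longrightarrow> inverse (Suc n) \<le> d x y)}" for n
  have "\<exists>A\<in>Sep n. \<forall>B\<in>Sep n. A \<subseteq> B \<longrightarrow> B = A" for n
  proof (rule subset_Zorn')
    fix c assume c: "subset.chain (Sep n) c"
    show "\<Union>c \<in> Sep n"
      unfolding Sep_def
    proof (intro CollectI conjI ballI impI)
      show "\<Union>c \<subseteq> M" using c by (auto simp: subset_chain_def Sep_def)
      fix x y assume "x \<in> \<Union>c" "y \<in> \<Union>c" "x \<noteq> y"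
      then obtain A A' where "A \<in> c" "x \<in> A" "A' \<in> c" "y \<in> A'" by blast
      moreover from this have "A \<subseteq> A' \<or> A' \<subseteq> A"
        using c unfolding subset_chain_def by blast
      ultimately obtain A where "A \<in> c" "x \<in> A" "y \<in> A" by blast
      then show "inverse (Suc n) \<le> d x y"
        using c \<open>x \<noteq> y\<close> by (auto simp: subset_chain_def Sep_def)
    qed
  qed
  then obtain A where A: "\<And>n. A n \<in> Sep n" "\<And>n B. \<lbrakk>B \<in> Sep n; A n \<subseteq> B\<rbrakk> \<Longrightarrow> B = A n"
    by metis
  have near: "\<exists>y\<in>A n. d x y < inverse (Suc n)" if "x \<in> M" for x n
  proof (rule ccontr)
    assume "\<not> ?thesis"
    then have far: "inverse (Suc n) \<le> d x y" if "y \<in> A n" for y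
      using that by force
    then have "insert x (A n) \<in> Sep n"
      using A(1)[of n] that by (auto simp: Sep_def commute)
    then have "x \<in> A n" using A(2) by blast
    then show False using far[of x] that by simp
  qed
  have "\<exists>n. uncountable (A n)"
  proof (rule ccontr)
    assume "\<not> ?thesis"
    then have "countable (\<Union>n. A n)" by simp
    moreover have "(\<Union>n. A n) \<subseteq> topspace X" using A(1) Xeq by (auto simp: Sep_def)
    moreover have "topspace X \<subseteq> X closure_of (\<Union>n. A n)"
    proof
      fix x assume "x \<in> topspace X"
      then have x: "x \<in> M" using Xeq by simp
      have "\<exists>y\<in>\<Union>n. A n. y \<in> mball x r" if "r > 0" for r
      proof -
        obtain n where "inverse (real (Suc n)) < r" using \<open>r > 0\<close> reals_Archimedean by blast
        then show ?thesis using near[OF x, of n] A(1)[of n] x by (fastforce simp: Sep_def)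
      qed
      then show "x \<in> X closure_of (\<Union>n. A n)" using x by (auto simp: Xeq metric_closure_of)
    qed
    ultimately show False
      using nsep closure_of_subset_topspace unfolding separable_space_def by (metis subset_antisym)
  qed
  then obtain n where n: "uncountable (A n)" by blast
  have DM: "A n \<subseteq> M" and far: "\<And>x y. \<lbrakk>x \<in> A n; y \<in> A n; x \<noteq> y\<rbrakk> \<Longrightarrow> inverse (Suc n) \<le> d x y"
    using A(1)[of n] by (auto simp: Sep_def)
  have isolated: "x \<in> S" if x: "x \<in> X closure_of S" and S: "S \<subseteq> A n" for x S
  proof -
    have xM: "x \<in> M" using x Xeq by (metis in_closure_of topspace_mtopology)
    obtain y where y: "y \<in> S" "y \<in> mball x (inverse (Suc n) / 2)"
      using closure_of_near[of x S "inverse (Suc n) / 2"] x unfolding Xeq by auto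
    have "x = y"
    proof (rule ccontr)
      assume "x \<noteq> y"
      then have "d x y > 0" using y by auto
      then obtain z where z: "z \<in> S" "z \<in> mball x (min (d x y) (inverse (Suc n) / 2))"
        using closure_of_near[of x S "min (d x y) (inverse (Suc n) / 2)"] x unfolding Xeq by auto
      then have "z \<noteq> y" by auto
      moreover have "d z y < inverse (Suc n)"
        using triangle[of z x y] z y commute[of x z] by auto
      ultimately show False using far[of z y] S z y by auto
    qed
    then show ?thesis using y by simp
  qed
  show thesis
  proof
    show "A n \<subseteq> topspace X" "uncountable (A n)" using DM n Xeq by auto
    show "closedin X S" if "S \<subseteq> A n" for S
      using isolated that DM Xeq by (subst closure_of_subset_eq[symmetric]) auto
    show "countable (A n \<inter> S)" if S: "separable_in X S" for S
    proof -
      have "separable_in X (A n \<inter> S)"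
        using separable_in_subset[OF X S] DM Xeq by auto
      then obtain C where "countable C" "C \<subseteq> A n \<inter> S" "A n \<inter> S \<subseteq> X closure_of C"
        using separable_in_iff[of "A n \<inter> S" X] DM Xeq by auto
      then have "A n \<inter> S \<subseteq> C" using isolated[of _ C] by blast
      then show ?thesis using \<open>countable C\<close> countable_subset by blast
    qed
  qed
qed

text \<open>A function that is 1 on \<open>S\<close> and has a separable cozero set shows that the closure of \<open>S\<close> in the
Stone-Cech compactification stays inside \<open>\<lambda>X\<close>, and gives a local unit of \<open>Cs X\<close>.\<close>

lemma separable_bump:
  assumes X: "metrizable_space X" and loc: "locally_separable_space X" and S: "separable_in X S"
  obtains u where "u \<in> unit_functions X" "\<And>x. x \<in> topspace X \<inter> S \<Longrightarrow> u x = 1"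
    "separable_in X {x \<in> topspace X. u x \<noteq> 0}"
proof -
  obtain V where V: "openin X V" "X closure_of S \<subseteq> V" "separable_in X V"
    using separable_open_neighbourhood_of_closure[OF assms] by blast
  have "closedin X (topspace X - V)" "disjnt (topspace X - V) (X closure_of S)"
    using V by (auto simp: disjnt_iff)
  then obtain f where f: "continuous_map X (top_of_set {0..1::real}) f"
      "f ` (topspace X - V) \<subseteq> {0}" "f ` (X closure_of S) \<subseteq> {1}"
    using Urysohn_lemma[OF metrizable_imp_normal_space[OF X], of "topspace X - V" "X closure_of S" 0 1] by auto
  define u where "u = restrict f (topspace X)"
  show thesis
  proof
    have "continuous_map X euclideanreal u"
      using f(1) by (auto simp: u_def continuous_map_in_subtopology intro: continuous_map_eq[of _ _ f])
    then show "u \<in> unit_functions X"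
      using f(1) by (auto simp: unit_functions_def u_def continuous_map_in_subtopology)
    have "topspace X \<inter> S \<subseteq> X closure_of S"
      by (metis closure_of_restrict closure_of_subset inf_le1)
    then show "u x = 1" if "x \<in> topspace X \<inter> S" for x
      using f(3) that by (auto simp: u_def)
    have "{x \<in> topspace X. u x \<noteq> 0} \<subseteq> V" using f(2) by (auto simp: u_def)
    then show "separable_in X {x \<in> topspace X. u x \<noteq> 0}"
      using separable_in_subset[OF X V(3)] by auto
  qed
qed

section \<open>Extension of bounded functions to the Stone-Cech compactification\<close>

lemma continuous_map_complex_mult:
  fixes f g :: "'a \<Rightarrow> complex"
  shows "\<lbrakk>continuous_map X euclidean f; continuous_map X euclidean g\<rbrakk>
     \<Longrightarrow> continuous_map X euclidean (\<lambda>x. f x * g x)"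
  by (simp add: continuous_map_atin tendsto_mult)

lemma continuous_map_complex_of_real:
  "continuous_map X euclideanreal f \<Longrightarrow> continuous_map X euclidean (\<lambda>x. complex_of_real (f x))"
  by (simp add: continuous_map_atin tendsto_of_real)

lemma continuous_map_complex_inverse:
  fixes f :: "'a \<Rightarrow> complex"
  assumes "continuous_map X euclidean f" "\<And>x. x \<in> topspace X \<Longrightarrow> f x \<noteq> 0"
  shows "continuous_map X euclidean (\<lambda>x. inverse (f x))"
  using assms by (simp add: continuous_map_atin tendsto_inverse)

lemma continuous_map_cnj:
  "continuous_map X euclidean f \<Longrightarrow> continuous_map X euclidean (\<lambda>x. cnj (f x))"
  by (simp add: continuous_map_atin tendsto_cnj)

lemma fun_add_in_Cb: "\<lbrakk>f \<in> Cb X; g \<in> Cb X\<rbrakk> \<Longrightarrow> fun_add X f g \<in> Cb X"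
  unfolding Cb_iff fun_add_def
  by (auto intro!: continuous_map_eq[OF continuous_map_add[of X f g]]
      bounded_subset[OF bounded_plus[of "f ` topspace X" "g ` topspace X"]])

lemma fun_mult_in_Cb:
  assumes "f \<in> Cb X" "g \<in> Cb X" shows "fun_mult X f g \<in> Cb X"
proof -
  obtain a b where "\<And>x. x \<in> topspace X \<Longrightarrow> cmod (f x) \<le> a" "\<And>x. x \<in> topspace X \<Longrightarrow> cmod (g x) \<le> b"
    using assms by (auto simp: Cb_iff bounded_iff)
  then have "cmod (f x * g x) \<le> a * b" if "x \<in> topspace X" for x
    using that by (auto simp: norm_mult intro!: mult_mono intro: order_trans[OF norm_ge_zero])
  moreover have "continuous_map X euclidean (\<lambda>x \<in> topspace X. f x * g x)"
    using assms by (auto simp: Cb_iff intro!: continuous_map_eq[OF continuous_map_complex_mult[of X f g]])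
  ultimately show ?thesis
    by (auto simp: Cb_iff fun_mult_def bounded_iff)
qed

lemma const_in_Cb: "(\<lambda>x \<in> topspace X. c) \<in> Cb X"
  by (auto simp: Cb_iff bounded_iff intro!: continuous_map_eq[of X euclidean "\<lambda>_. c"])

lemma fun_scale_eq_fun_mult: "fun_scale X c f = fun_mult X (\<lambda>x \<in> topspace X. c) f"
  by (auto simp: fun_scale_def fun_mult_def)

lemma homeomorphic_map_evaluation:
  assumes "metrizable_space X"
  shows "homeomorphic_map X (subtopology (stone_cech X) (evaluation X ` topspace X)) (evaluation X)"
  using embedding_map_stone_cech[of X] assms
  by (simp add: embedding_map_def metrizable_imp_completely_regular_space metrizable_imp_Hausdorff_space)

lemma continuous_map_evaluation:
  assumes "metrizable_space X"
  shows "continuous_map X (stone_cech X) (evaluation X)"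
  using homeomorphic_imp_continuous_map[OF homeomorphic_map_evaluation[OF assms]]
  by (simp add: continuous_map_in_subtopology)

lemma evaluation_in_stone_cech: "x \<in> topspace X \<Longrightarrow> evaluation X x \<in> topspace (stone_cech X)"
  using evaluation_in_cube[of X] closure_of_subset[OF evaluation_in_cube, of X]
  by (auto simp: stone_cech_def topspace_subtopology)

lemma continuous_map_stone_cech_coordinate:
  "u \<in> unit_functions X \<Longrightarrow> continuous_map (stone_cech X) (top_of_set {0..1}) (\<lambda>p. p u)"
  unfolding stone_cech_def cube_def
  by (intro continuous_map_from_subtopology continuous_map_product_projection)

lemma restriction_in_Cb:
  assumes X: "metrizable_space X" and G: "continuous_map (stone_cech X) euclidean G"
  shows "(\<lambda>x \<in> topspace X. G (evaluation X x)) \<in> Cb X"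
proof -
  have "continuous_map X euclidean (\<lambda>x. G (evaluation X x))"
    using continuous_map_compose[OF continuous_map_evaluation[OF X] G] by (simp add: o_def)
  moreover have "compact (G ` topspace (stone_cech X))"
    using image_compactin[OF _ G] compact_space_stone_cech[of X] by (simp add: compact_space_def)
  then have "bounded ((\<lambda>x. G (evaluation X x)) ` topspace X)"
    using evaluation_in_stone_cech by (auto intro!: imageI bounded_subset[OF compact_imp_bounded])
  ultimately show ?thesis
    by (auto simp: Cb_iff intro: continuous_map_eq)
qed

text \<open>Real and imaginary parts are rescaled to functions with values in the unit interval, and these
extend because they are coordinates of the cube that contains the compactification.\<close>

lemma extension_of_Cb:
  assumes "f \<in> Cb X"
  shows "\<exists>F. continuous_map (stone_cech X) euclidean F \<and> (\<forall>x \<in> topspace X. F (evaluation X x) = f x)"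
proof -
  obtain b where b: "b > 0" "\<And>x. x \<in> topspace X \<Longrightarrow> cmod (f x) \<le> b"
    using assms by (auto simp: Cb_iff bounded_pos)
  have cont: "continuous_map X euclidean f" using assms by (simp add: Cb_iff)
  have ext_part: "\<exists>F. continuous_map (stone_cech X) euclideanreal F \<and> (\<forall>x \<in> topspace X. F (evaluation X x) = g x)"
    if g: "continuous_map X euclideanreal g" "\<And>x. x \<in> topspace X \<Longrightarrow> \<bar>g x\<bar> \<le> b" for g
  proof -
    define u where "u = (\<lambda>x \<in> topspace X. (g x + b) / (2 * b))"
    have "continuous_map X euclideanreal (\<lambda>x. (g x + b) / (2 * b))"
      using g(1) b(1) by (intro continuous_intros) auto
    then have "continuous_map X euclideanreal u"
      by (rule continuous_map_eq) (simp add: u_def)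
    moreover have "u x \<in> {0..1}" if "x \<in> topspace X" for x
      using g(2)[OF that] b(1) that by (auto simp: u_def abs_le_iff divide_simps)
    ultimately have "u \<in> unit_functions X" by (auto simp: unit_functions_def u_def)
    then obtain F where F: "continuous_map (stone_cech X) (top_of_set {0..1}) F"
        "\<forall>x \<in> topspace X. F (evaluation X x) = u x"
      using extension_stone_cech by blast
    have "continuous_map (stone_cech X) euclideanreal (\<lambda>p. 2 * b * F p - b)"
      using F(1) by (intro continuous_intros) (simp_all add: continuous_map_in_subtopology)
    moreover have "\<forall>x \<in> topspace X. 2 * b * F (evaluation X x) - b = g x"
      using F(2) b(1) by (simp add: u_def field_simps)
    ultimately show ?thesis by blast
  qed
  have "continuous_map X euclideanreal (\<lambda>x. Re (f x))" "continuous_map X euclideanreal (\<lambda>x. Im (f x))"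
    using cont by (simp_all add: continuous_map_atin tendsto_Re tendsto_Im)
  moreover have "\<bar>Re (f x)\<bar> \<le> b" "\<bar>Im (f x)\<bar> \<le> b" if "x \<in> topspace X" for x
    using b(2)[OF that] abs_Re_le_cmod[of "f x"] abs_Im_le_cmod[of "f x"] by linarith+
  ultimately obtain R J where RJ:
      "continuous_map (stone_cech X) euclideanreal R" "\<forall>x \<in> topspace X. R (evaluation X x) = Re (f x)"
      "continuous_map (stone_cech X) euclideanreal J" "\<forall>x \<in> topspace X. J (evaluation X x) = Im (f x)"
    using ext_part[of "\<lambda>x. Re (f x)"] ext_part[of "\<lambda>x. Im (f x)"] by auto
  show ?thesis
  proof (intro exI conjI ballI)
    show "continuous_map (stone_cech X) euclidean (\<lambda>p. complex_of_real (R p) + \<i> * complex_of_real (J p))"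
      using RJ by (intro continuous_map_add continuous_map_complex_mult continuous_map_complex_of_real) auto
  qed (use RJ complex_eq in auto)
qed

text \<open>The choice is harmless: only the values on the compactification matter, and there the extension
is determined by density of the image of \<open>X\<close>.\<close>

definition stone_cech_extension :: "'a topology \<Rightarrow> ('a \<Rightarrow> complex) \<Rightarrow> (('a \<Rightarrow> real) \<Rightarrow> real) \<Rightarrow> complex"
  where "stone_cech_extension X f =
     (SOME F. continuous_map (stone_cech X) euclidean F \<and> (\<forall>x \<in> topspace X. F (evaluation X x) = f x))"

context
  fixes X :: "'a topology" and f :: "'a \<Rightarrow> complex"
  assumes f: "f \<in> Cb X"
begin

lemma continuous_map_stone_cech_extension:
    "continuous_map (stone_cech X) euclidean (stone_cech_extension X f)"
  and stone_cech_extension_evaluation: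
    "x \<in> topspace X \<Longrightarrow> stone_cech_extension X f (evaluation X x) = f x"
  using someI_ex[OF extension_of_Cb[OF f]] unfolding stone_cech_extension_def by blast+

lemma stone_cech_extension_unique:
  assumes "continuous_map (stone_cech X) euclidean G"
    and "\<And>x. x \<in> topspace X \<Longrightarrow> G (evaluation X x) = f x"
    and "p \<in> topspace (stone_cech X)"
  shows "stone_cech_extension X f p = G p"
proof (rule forall_in_closure_of_eq[where x = p and f = "stone_cech_extension X f" and g = G])
  show "p \<in> stone_cech X closure_of (evaluation X ` topspace X)"
    using assms(3) by (simp add: dense_stone_cech)
qed (use assms continuous_map_stone_cech_extension stone_cech_extension_evaluation in auto)

end

lemma stone_cech_extension_fun_add:
  assumes f: "f \<in> Cb X" and g: "g \<in> Cb X" and p: "p \<in> topspace (stone_cech X)"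
  shows "stone_cech_extension X (fun_add X f g) p = stone_cech_extension X f p + stone_cech_extension X g p"
  by (rule stone_cech_extension_unique[OF fun_add_in_Cb[OF f g] _ _ p])
    (auto simp: stone_cech_extension_evaluation fun_add_def f g
      intro!: continuous_map_add continuous_map_stone_cech_extension)

lemma stone_cech_extension_fun_mult:
  assumes f: "f \<in> Cb X" and g: "g \<in> Cb X" and p: "p \<in> topspace (stone_cech X)"
  shows "stone_cech_extension X (fun_mult X f g) p = stone_cech_extension X f p * stone_cech_extension X g p"
  by (rule stone_cech_extension_unique[OF fun_mult_in_Cb[OF f g] _ _ p])
    (auto simp: stone_cech_extension_evaluation fun_mult_def f g
      intro!: continuous_map_complex_mult continuous_map_stone_cech_extension)

lemma stone_cech_extension_const:
  assumes "p \<in> topspace (stone_cech X)"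
  shows "stone_cech_extension X (\<lambda>x \<in> topspace X. c) p = c"
  by (rule stone_cech_extension_unique[OF const_in_Cb _ _ assms]) auto

lemma stone_cech_extension_restriction:
  assumes "metrizable_space X" "continuous_map (stone_cech X) euclidean G" "p \<in> topspace (stone_cech X)"
  shows "stone_cech_extension X (\<lambda>x \<in> topspace X. G (evaluation X x)) p = G p"
  by (rule stone_cech_extension_unique[OF restriction_in_Cb[OF assms(1,2)] assms(2) _ assms(3)]) auto

section \<open>Functions with separable support and the subspace lambda\<close>

lemma Cs_iff:
  assumes "metrizable_space X"
  shows "f \<in> Cs X \<longleftrightarrow> f \<in> Cb X \<and> separable_in X (coz X f)"
proof -
  have "coz X f \<subseteq> topspace X" by (auto simp: coz_def)
  then have "separable_in X (supp X f) \<longleftrightarrow> separable_in X (coz X f)"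
    unfolding supp_def
    using separable_in_subset[OF assms, of "X closure_of coz X f" "coz X f"]
      separable_in_subset_closure[OF assms, of "coz X f" "X closure_of coz X f"] closure_of_subset[of "coz X f" X]
    by auto
  then show ?thesis by (simp add: Cs_def)
qed

lemma fun_add_in_Cs:
  assumes X: "metrizable_space X" and "f \<in> Cs X" "g \<in> Cs X"
  shows "fun_add X f g \<in> Cs X"
proof -
  have "separable_in X (\<Union>{coz X f, coz X g})"
    using assms by (intro separable_in_Union) (auto simp: Cs_iff coz_def)
  then have "separable_in X (coz X (fun_add X f g))"
    by (rule separable_in_subset[OF X]) (auto simp: coz_def fun_add_def)
  then show ?thesis using assms by (simp add: Cs_iff fun_add_in_Cb)
qed

lemma fun_mult_in_Cs:
  assumes X: "metrizable_space X" and "f \<in> Cs X" "g \<in> Cb X"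
  shows "fun_mult X f g \<in> Cs X" "fun_mult X g f \<in> Cs X"
proof -
  have f: "separable_in X (coz X f)" using assms by (simp add: Cs_iff)
  have "separable_in X (coz X (fun_mult X f g))" "separable_in X (coz X (fun_mult X g f))"
    by (rule separable_in_subset[OF X f]; auto simp: coz_def fun_mult_def)+
  then show "fun_mult X f g \<in> Cs X" "fun_mult X g f \<in> Cs X"
    using assms by (simp_all add: Cs_iff fun_mult_in_Cb)
qed

lemma Cs_subset_Cb: "f \<in> Cs X \<Longrightarrow> f \<in> Cb X"
  by (simp add: Cs_def)

lemma fun_scale_in_Cs: "\<lbrakk>metrizable_space X; f \<in> Cs X\<rbrakk> \<Longrightarrow> fun_scale X c f \<in> Cs X"
  by (simp add: fun_scale_eq_fun_mult fun_mult_in_Cs const_in_Cb)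

lemma Cs_bump:
  assumes X: "metrizable_space X" and loc: "locally_separable_space X"
    and S: "S \<subseteq> topspace X" "separable_in X S"
  obtains f where "f \<in> Cs X"
    "\<And>p. p \<in> stone_cech X closure_of (evaluation X ` S) \<Longrightarrow> stone_cech_extension X f p = 1"
proof -
  obtain u where u: "u \<in> unit_functions X" "\<And>x. x \<in> topspace X \<inter> S \<Longrightarrow> u x = 1"
      "separable_in X {x \<in> topspace X. u x \<noteq> 0}"
    using separable_bump[OF X loc S(2)] by blast
  define G where "G p = complex_of_real (p u)" for p
  have G: "continuous_map (stone_cech X) euclidean G"
    using continuous_map_stone_cech_coordinate[OF u(1)] unfolding G_def
    by (intro continuous_map_complex_of_real) (simp add: continuous_map_in_subtopology)
  define f where "f = (\<lambda>x \<in> topspace X. G (evaluation X x))"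
  have fx: "f x = u x" if "x \<in> topspace X" for x
    using that u(1) by (simp add: f_def G_def evaluation_def)
  show thesis
  proof
    have "coz X f = {x \<in> topspace X. u x \<noteq> 0}" by (auto simp: coz_def fx)
    then show fC: "f \<in> Cs X"
      using restriction_in_Cb[OF X G] u(3) by (simp add: Cs_iff[OF X] f_def)
    fix p assume p: "p \<in> stone_cech X closure_of (evaluation X ` S)"
    show "stone_cech_extension X f p = 1"
    proof (rule forall_in_closure_of_eq[OF p, of euclidean _ "\<lambda>_. 1"])
      show "continuous_map (stone_cech X) euclidean (stone_cech_extension X f)"
        by (intro continuous_map_stone_cech_extension Cs_subset_Cb fC)
      show "stone_cech_extension X f q = 1" if "q \<in> evaluation X ` S" for q
        using that S(1) u(2) fx fC by (auto simp: stone_cech_extension_evaluation Cs_subset_Cb)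
    qed auto
  qed
qed

text \<open>This is the link between \<open>\<lambda>X\<close> and the algebra: \<open>\<lambda>X\<close> is the set of points at which evaluation
does not annihilate \<open>Cs X\<close>. If the extension of \<open>f\<close> does not vanish at \<open>p\<close>, then it is nonzero
on an open set, which by density lies in the closure of the cozero set of \<open>f\<close>; conversely a bump
function for a separable set takes the value 1 on the whole closure of that set.\<close>

lemma lambda_set_iff:
  assumes X: "metrizable_space X" and loc: "locally_separable_space X"
  shows "p \<in> lambda_set X \<longleftrightarrow>
    p \<in> topspace (stone_cech X) \<and> (\<exists>f \<in> Cs X. stone_cech_extension X f p \<noteq> 0)"
proof
  assume "p \<in> lambda_set X"
  then obtain C where C: "C \<in> Coz X" "separable_in X C"
      "p \<in> stone_cech X interior_of (stone_cech X closure_of (evaluation X ` C))"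
    by (auto simp: lambda_set_def)
  have "C \<subseteq> topspace X" using C(1) by (auto simp: Coz_def coz_def)
  then obtain f where f: "f \<in> Cs X"
    "\<And>p. p \<in> stone_cech X closure_of (evaluation X ` C) \<Longrightarrow> stone_cech_extension X f p = 1"
    using Cs_bump[OF X loc _ C(2)] by blast
  have "p \<in> stone_cech X closure_of (evaluation X ` C)"
    using C(3) interior_of_subset by (rule subsetD[rotated])
  then have "p \<in> topspace (stone_cech X)" "stone_cech_extension X f p = 1"
    using f(2) by (auto simp: in_closure_of)
  then show "p \<in> topspace (stone_cech X) \<and> (\<exists>f \<in> Cs X. stone_cech_extension X f p \<noteq> 0)"
    using f(1) by force
next
  assume "p \<in> topspace (stone_cech X) \<and> (\<exists>f \<in> Cs X. stone_cech_extension X f p \<noteq> 0)"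
  then obtain f where f: "f \<in> Cs X" and p: "stone_cech_extension X f p \<noteq> 0" "p \<in> topspace (stone_cech X)"
    by blast
  define U where "U = {q \<in> topspace (stone_cech X). stone_cech_extension X f q \<in> - {0}}"
  have U: "openin (stone_cech X) U"
    unfolding U_def
    by (rule openin_continuous_map_preimage[OF continuous_map_stone_cech_extension[OF Cs_subset_Cb[OF f]]])
      (simp add: open_Compl)
  have "U \<subseteq> stone_cech X closure_of (U \<inter> evaluation X ` topspace X)"
    using openin_Int_closure_of_subset[OF U, of "evaluation X ` topspace X"] openin_subset[OF U]
    by (simp add: dense_stone_cech Int_absorb2)
  also have "\<dots> \<subseteq> stone_cech X closure_of (evaluation X ` coz X f)"
    by (rule closure_of_mono) (auto simp: U_def coz_def stone_cech_extension_evaluation[OF Cs_subset_Cb[OF f]])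
  finally have "p \<in> stone_cech X interior_of (stone_cech X closure_of (evaluation X ` coz X f))"
    using interior_of_maximal[OF _ U] p by (auto simp: U_def)
  moreover have "coz X f \<in> Coz X" "separable_in X (coz X f)"
    using f by (auto simp: Coz_def Cs_iff[OF X])
  ultimately show "p \<in> lambda_set X"
    unfolding lambda_set_def by blast
qed

lemma closure_subset_lambda_set:
  assumes X: "metrizable_space X" and loc: "locally_separable_space X"
    and S: "S \<subseteq> topspace X" "separable_in X S"
  shows "stone_cech X closure_of (evaluation X ` S) \<subseteq> lambda_set X"
proof
  fix p assume p: "p \<in> stone_cech X closure_of (evaluation X ` S)"
  obtain f where f: "f \<in> Cs X"
    "\<And>p. p \<in> stone_cech X closure_of (evaluation X ` S) \<Longrightarrow> stone_cech_extension X f p = 1"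
    using Cs_bump[OF assms] by blast
  then show "p \<in> lambda_set X"
    using p f unfolding lambda_set_iff[OF X loc] by (auto simp: in_closure_of intro!: bexI[of _ f])
qed

lemma openin_lambda_set: "openin (stone_cech X) (lambda_set X)"
  unfolding lambda_set_def by (rule openin_Union) auto

lemma topspace_lambda_space: "topspace (lambda_space X) = lambda_set X"
  using openin_subset[OF openin_lambda_set, of X]
  by (simp add: lambda_space_def topspace_subtopology Int_absorb1)

lemma openin_lambda_space: "openin (lambda_space X) U \<longleftrightarrow> openin (stone_cech X) U \<and> U \<subseteq> lambda_set X"
  unfolding lambda_space_def by (rule openin_open_subtopology[OF openin_lambda_set])

lemma lambda_set_closure:
  assumes "p \<in> lambda_set X"
  obtains S where "S \<subseteq> topspace X" "separable_in X S"
    "p \<in> stone_cech X interior_of (stone_cech X closure_of (evaluation X ` S))"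
    "p \<in> stone_cech X closure_of (evaluation X ` S)"
proof -
  obtain C where C: "C \<in> Coz X" "separable_in X C"
      "p \<in> stone_cech X interior_of (stone_cech X closure_of (evaluation X ` C))"
    using assms by (auto simp: lambda_set_def)
  moreover have "C \<subseteq> topspace X" using C(1) by (auto simp: Coz_def coz_def)
  moreover have "p \<in> stone_cech X closure_of (evaluation X ` C)"
    using C(3) interior_of_subset by (rule subsetD[rotated])
  ultimately show thesis using that by blast
qed

lemma locally_compact_space_lambda: "locally_compact_space (lambda_space X)"
  unfolding lambda_space_def
  using Hausdorff_space_stone_cech compact_imp_locally_compact_space[OF compact_space_stone_cech] openin_lambda_set
  by (blast intro: locally_compact_space_open_subset)

text \<open>Countable unions of separable sets are separable; therefore countable subsets of \<open>\<lambda>X\<close> are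
relatively compact in \<open>\<lambda>X\<close>, which yields countable compactness.\<close>

lemma countable_subset_lambda_closure:
  assumes X: "metrizable_space X" and A: "countable A" "A \<subseteq> lambda_set X"
  obtains S where "S \<subseteq> topspace X" "separable_in X S" "A \<subseteq> stone_cech X closure_of (evaluation X ` S)"
proof -
  have "\<forall>p\<in>A. \<exists>S. S \<subseteq> topspace X \<and> separable_in X S \<and> p \<in> stone_cech X closure_of (evaluation X ` S)"
  proof
    fix p assume "p \<in> A"
    then have "p \<in> lambda_set X" using A(2) by auto
    from lambda_set_closure[OF this]
    show "\<exists>S. S \<subseteq> topspace X \<and> separable_in X S \<and> p \<in> stone_cech X closure_of (evaluation X ` S)"
      by metis
  qed
  then obtain s where s: "\<And>p. p \<in> A \<Longrightarrow> s p \<subseteq> topspace X \<and> separable_in X (s p)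
      \<and> p \<in> stone_cech X closure_of (evaluation X ` s p)"
    by metis
  show thesis
  proof
    show "\<Union>(s ` A) \<subseteq> topspace X" using s by auto
    show "separable_in X (\<Union>(s ` A))"
      using s A(1) by (intro separable_in_Union) auto
    show "A \<subseteq> stone_cech X closure_of (evaluation X ` \<Union>(s ` A))"
    proof
      fix p assume p: "p \<in> A"
      have "stone_cech X closure_of (evaluation X ` s p) \<subseteq> stone_cech X closure_of (evaluation X ` \<Union>(s ` A))"
        using p by (intro closure_of_mono image_mono) auto
      then show "p \<in> stone_cech X closure_of (evaluation X ` \<Union>(s ` A))"
        using s[OF p] by auto
    qed
  qed
qed

lemma countably_compact_space_lambda:
  assumes X: "metrizable_space X" and loc: "locally_separable_space X"
  shows "countably_compact_space (lambda_space X)"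
  unfolding countably_compact_space_def topspace_lambda_space
proof (intro allI impI, elim conjE, rule ccontr)
  fix \<U> :: "(('a \<Rightarrow> real) \<Rightarrow> real) set set"
  assume \<U>: "countable \<U>" "\<forall>U \<in> \<U>. openin (lambda_space X) U" "lambda_set X \<subseteq> \<Union>\<U>"
    and none: "\<nexists>\<F>. finite \<F> \<and> \<F> \<subseteq> \<U> \<and> lambda_set X \<subseteq> \<Union>\<F>"
  \<comment> \<open>One point outside each finite subfamily: countably many points, so they lie in a common compact subset of the space.\<close>
  have "\<forall>\<F>. finite \<F> \<and> \<F> \<subseteq> \<U> \<longrightarrow> (\<exists>p. p \<in> lambda_set X - \<Union>\<F>)"
    using none by blast
  then obtain p where p: "\<And>\<F>. finite \<F> \<Longrightarrow> \<F> \<subseteq> \<U> \<Longrightarrow> p \<F> \<in> lambda_set X - \<Union>\<F>"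
    by metis
  define A where "A = p ` {\<F>. finite \<F> \<and> \<F> \<subseteq> \<U>}"
  have "countable A" "A \<subseteq> lambda_set X"
    using p \<U>(1) by (auto simp: A_def countable_Collect_finite_subset)
  then obtain S where S: "S \<subseteq> topspace X" "separable_in X S"
      "A \<subseteq> stone_cech X closure_of (evaluation X ` S)"
    using countable_subset_lambda_closure[OF X] by metis
  have "compactin (stone_cech X) (stone_cech X closure_of (evaluation X ` S))"
    by (simp add: closedin_compact_space compact_space_stone_cech)
  moreover have "\<forall>U \<in> \<U>. openin (stone_cech X) U"
    using \<U>(2) by (simp add: openin_lambda_space)
  moreover have "stone_cech X closure_of (evaluation X ` S) \<subseteq> \<Union>\<U>"
    using closure_subset_lambda_set[OF X loc S(1,2)] \<U>(3) by (rule order_trans)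
  ultimately obtain \<F> where \<F>: "finite \<F>" "\<F> \<subseteq> \<U>" "stone_cech X closure_of (evaluation X ` S) \<subseteq> \<Union>\<F>"
    unfolding compactin_def by meson
  have "p \<F> \<in> A" using \<F> by (auto simp: A_def)
  then show False using S(3) \<F> p[OF \<F>(1,2)] by auto
qed

section \<open>Characters as point evaluations\<close>

definition point_character :: "'a topology \<Rightarrow> (('a \<Rightarrow> real) \<Rightarrow> real) \<Rightarrow> ('a \<Rightarrow> complex) \<Rightarrow> complex"
  where "point_character X p = (\<lambda>f \<in> Cs X. stone_cech_extension X f p)"

lemma point_character_in_characters:
  assumes X: "metrizable_space X" and loc: "locally_separable_space X" and p: "p \<in> lambda_set X"
  shows "point_character X p \<in> characters X (Cs X)"
proof -
  have pt: "p \<in> topspace (stone_cech X)" and nz: "\<exists>f \<in> Cs X. stone_cech_extension X f p \<noteq> 0"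
    using p by (auto simp: lambda_set_iff[OF X loc])
  show ?thesis
    using nz unfolding characters_def linear_functional_def point_character_def
    by (auto simp: fun_add_in_Cs fun_mult_in_Cs fun_scale_in_Cs X Cs_subset_Cb const_in_Cb pt
        stone_cech_extension_fun_add stone_cech_extension_fun_mult
        stone_cech_extension_const fun_scale_eq_fun_mult)
qed

lemma character_sum:
  assumes X: "metrizable_space X" and \<phi>: "\<phi> \<in> characters X (Cs X)"
    and F: "finite F" "\<And>i. i \<in> F \<Longrightarrow> h i \<in> Cs X"
  shows "(\<lambda>x \<in> topspace X. \<Sum>i\<in>F. h i x) \<in> Cs X \<and> \<phi> (\<lambda>x \<in> topspace X. \<Sum>i\<in>F. h i x) = (\<Sum>i\<in>F. \<phi> (h i))"
  using F
proof (induction F rule: finite_induct)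
  case empty
  obtain f where f: "f \<in> Cs X" using \<phi> by (auto simp: characters_def)
  have "(\<lambda>x \<in> topspace X. 0) = fun_scale X 0 f" by (auto simp: fun_scale_def)
  then show ?case
    using f \<phi> fun_scale_in_Cs[OF X f, of 0] by (simp add: characters_def linear_functional_def)
next
  case (insert i F)
  let ?G = "\<lambda>x \<in> topspace X. \<Sum>i\<in>F. h i x"
  have eq: "(\<lambda>x \<in> topspace X. \<Sum>i\<in>insert i F. h i x) = fun_add X (h i) ?G"
    using insert.hyps by (auto simp: fun_add_def)
  have G: "?G \<in> Cs X" "\<phi> ?G = (\<Sum>i\<in>F. \<phi> (h i))" and hi: "h i \<in> Cs X"
    using insert.IH insert.prems by blast+
  have "\<phi> (fun_add X (h i) ?G) = \<phi> (h i) + \<phi> ?G"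
    using \<phi> hi G(1) unfolding characters_def linear_functional_def by blast
  then show ?case
    unfolding eq using fun_add_in_Cs[OF X hi G(1)] G(2) insert.hyps by simp
qed

text \<open>Suppose that \<open>\<phi>\<close> is evaluation at no point of the compactification. By compactness finitely many
\<open>f \<in> F \<subseteq> Cs X\<close> witness this, so the functions \<open>K f = f - \<phi> f\<close>, extended to the compactification,
have no common zero and \<open>s = \<Sum>f\<in>F. \<bar>K f\<bar>\<^sup>2\<close> is invertible. Then
\<open>g = \<Sum>f\<in>F. K f * (cnj (K f) / s * g)\<close> for every \<open>g\<close> in \<open>Cs X\<close>. The functions \<open>K f\<close> need not
be in \<open>Cs X\<close>, but \<open>K f * h\<close> is for \<open>h\<close> in \<open>Cs X\<close>, and \<open>\<phi>\<close> maps it to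
\<open>\<phi> f * \<phi> h - \<phi> f * \<phi> h = 0\<close>. So \<open>\<phi>\<close> vanishes, which a character does not.\<close>

lemma character_is_evaluation:
  assumes X: "metrizable_space X" and \<phi>: "\<phi> \<in> characters X (Cs X)"
  obtains p where "p \<in> topspace (stone_cech X)" "\<And>f. f \<in> Cs X \<Longrightarrow> \<phi> f = stone_cech_extension X f p"
proof (rule ccontr)
  assume "\<not> thesis"
  with that have none: "\<And>p. p \<in> topspace (stone_cech X) \<Longrightarrow> \<exists>f \<in> Cs X. \<phi> f \<noteq> stone_cech_extension X f p"
    by blast
  define K where "K f p = stone_cech_extension X f p - \<phi> f" for f p
  have contK: "continuous_map (stone_cech X) euclidean (K f)" if "f \<in> Cs X" for f
    unfolding K_def using that
    by (intro continuous_map_diff continuous_map_stone_cech_extension Cs_subset_Cb) auto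
  define U where "U f = {p \<in> topspace (stone_cech X). K f p \<in> - {0}}" for f
  have "openin (stone_cech X) (U f)" if "f \<in> Cs X" for f
    unfolding U_def by (rule openin_continuous_map_preimage[OF contK[OF that]]) (simp add: open_Compl)
  moreover have "topspace (stone_cech X) \<subseteq> \<Union>(U ` Cs X)"
    using none by (force simp: U_def K_def)
  ultimately obtain \<F> where "finite \<F>" "\<F> \<subseteq> U ` Cs X" "topspace (stone_cech X) \<subseteq> \<Union>\<F>"
    using compact_space_stone_cech[of X] unfolding compact_space_alt
    by (metis (no_types, lifting) image_iff)
  then obtain F where F: "finite F" "F \<subseteq> Cs X" "topspace (stone_cech X) \<subseteq> \<Union>(U ` F)"
    by (metis finite_subset_image)
  define s where "s p = (\<Sum>f\<in>F. cnj (K f p) * K f p)" for p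
  have s_nz: "s p \<noteq> 0" if p: "p \<in> topspace (stone_cech X)" for p
  proof -
    obtain f where f: "f \<in> F" "K f p \<noteq> 0" using F(3) p by (auto simp: U_def)
    have "s p = of_real (\<Sum>f\<in>F. (cmod (K f p))\<^sup>2)"
      unfolding s_def of_real_sum by (intro sum.cong) (simp_all add: complex_norm_square mult.commute del: of_real_power)
    moreover have "(\<Sum>f\<in>F. (cmod (K f p))\<^sup>2) > 0"
      using F(1) f by (intro sum_pos2[of F f]) auto
    ultimately show ?thesis by (simp del: of_real_sum of_real_power)
  qed
  have conts: "continuous_map (stone_cech X) euclidean s"
    unfolding s_def using F
    by (intro continuous_map_sum continuous_map_complex_mult continuous_map_cnj contK) auto
  define M where "M f p = cnj (K f p) * inverse (s p)" for f p
  define m where "m f = (\<lambda>x \<in> topspace X. M f (evaluation X x))" for f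
  have m: "m f \<in> Cb X" if "f \<in> F" for f
    unfolding m_def M_def using that F(2) s_nz conts
    by (intro restriction_in_Cb[OF X] continuous_map_complex_mult continuous_map_cnj
        continuous_map_complex_inverse contK) auto
  obtain g where g: "g \<in> Cs X" "\<phi> g \<noteq> 0" using \<phi> by (auto simp: characters_def)
  define h where "h f = fun_mult X (m f) g" for f
  have h: "h f \<in> Cs X" if "f \<in> F" for f
    unfolding h_def using fun_mult_in_Cs[OF X g(1)] m[OF that] by simp
  define t where "t f = fun_add X (fun_mult X f (h f)) (fun_scale X (- \<phi> f) (h f))" for f
  have fC: "f \<in> Cs X" if "f \<in> F" for f using that F(2) by auto
  have fh: "fun_mult X f (h f) \<in> Cs X" if "f \<in> F" for f
    using fun_mult_in_Cs[OF X fC[OF that]] h[OF that] Cs_subset_Cb by blast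
  have t: "t f \<in> Cs X" "\<phi> (t f) = 0" if "f \<in> F" for f
    using fun_add_in_Cs[OF X fh[OF that] fun_scale_in_Cs[OF X h[OF that]]] \<phi> fC[OF that] h[OF that]
      fh[OF that] fun_scale_in_Cs[OF X h[OF that]]
    by (simp_all add: t_def characters_def linear_functional_def)
  have "g = (\<lambda>x \<in> topspace X. \<Sum>f\<in>F. t f x)"
  proof
    fix x show "g x = (\<lambda>x \<in> topspace X. \<Sum>f\<in>F. t f x) x"
    proof (cases "x \<in> topspace X")
      case True
      let ?p = "evaluation X x"
      have "t f x = (cnj (K f ?p) * K f ?p) * (inverse (s ?p) * g x)" if "f \<in> F" for f
        using True stone_cech_extension_evaluation[OF Cs_subset_Cb[OF fC[OF that]] True]
        by (simp add: t_def h_def m_def M_def K_def fun_add_def fun_mult_def fun_scale_def algebra_simps)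
      then have "(\<Sum>f\<in>F. t f x) = s ?p * (inverse (s ?p) * g x)"
        by (simp add: s_def sum_distrib_right)
      also have "\<dots> = g x"
        using s_nz[OF evaluation_in_stone_cech[OF True]] by simp
      finally show ?thesis using True by simp
    next
      case False
      then show ?thesis using g(1) by (simp add: Cs_def Cb_iff extensional_def)
    qed
  qed
  then have "\<phi> g = (\<Sum>f\<in>F. \<phi> (t f))"
    using character_sum[OF X \<phi> F(1), of t] t(1) by simp
  then show False using t(2) g(2) by simp
qed

lemma continuous_map_spectrum_apply:
  "h \<in> A \<Longrightarrow> continuous_map (spectrum X A) euclidean (\<lambda>\<phi>. \<phi> h)"
  unfolding spectrum_def weak_star_topology_def
  by (intro continuous_map_from_subtopology continuous_map_product_projection)

text \<open>Injectivity and openness come from multiplying functions on the compactification with a local unit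
of \<open>Cs X\<close>, which moves them into the algebra without changing them at the points in question:
coordinates of the cube give injectivity, and Urysohn functions give openness.\<close>

lemma homeomorphic_map_point_character:
  assumes X: "metrizable_space X" and loc: "locally_separable_space X" and ne: "topspace X \<noteq> {}"
  shows "homeomorphic_map (lambda_space X) (spectrum X (Cs X)) (point_character X)"
proof (rule bijective_open_imp_homeomorphic_map)
  let ?\<Phi> = "point_character X"
  note char = point_character_in_characters[OF X loc]
  have top: "topspace (spectrum X (Cs X)) = characters X (Cs X)"
    by (rule topspace_spectrum_Cs[OF ne])
  have sub: "lambda_set X \<subseteq> topspace (stone_cech X)"
    by (rule openin_subset[OF openin_lambda_set])
  have "characters X (Cs X) \<subseteq> dual_space X (Cs X)"
    using top by (auto simp: spectrum_def weak_star_topology_def topspace_subtopology)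
  then show "continuous_map (lambda_space X) (spectrum X (Cs X)) ?\<Phi>"
    unfolding spectrum_def weak_star_topology_def continuous_map_in_subtopology continuous_map_componentwise
    using char
    by (auto simp: topspace_lambda_space point_character_def lambda_space_def
        intro!: continuous_map_from_subtopology continuous_map_stone_cech_extension Cs_subset_Cb)
  show onto: "?\<Phi> ` topspace (lambda_space X) = topspace (spectrum X (Cs X))"
    unfolding top topspace_lambda_space
  proof (intro equalityI subsetI)
    fix \<phi> assume \<phi>: "\<phi> \<in> characters X (Cs X)"
    obtain p where p: "p \<in> topspace (stone_cech X)" "\<And>f. f \<in> Cs X \<Longrightarrow> \<phi> f = stone_cech_extension X f p"
      using character_is_evaluation[OF X \<phi>] by blast
    have "\<phi> = ?\<Phi> p"
      using \<phi> p(2) by (auto simp: point_character_def characters_def linear_functional_def extensional_def)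
    moreover have "p \<in> lambda_set X"
      using \<phi> p by (auto simp: lambda_set_iff[OF X loc] characters_def)
    ultimately show "\<phi> \<in> ?\<Phi> ` lambda_set X" by blast
  qed (use char in auto)
  have bump: "\<exists>g \<in> Cs X. stone_cech_extension X g p = 1 \<and> stone_cech_extension X g q = 1"
    if pq: "p \<in> lambda_set X" "q \<in> lambda_set X" for p q
  proof -
    obtain S where "S \<subseteq> topspace X" "separable_in X S" "{p, q} \<subseteq> stone_cech X closure_of (evaluation X ` S)"
      using countable_subset_lambda_closure[OF X, of "{p, q}"] pq by auto
    then show ?thesis using Cs_bump[OF X loc, of S] by (metis insert_subset)
  qed
  show "inj_on ?\<Phi> (topspace (lambda_space X))"
    unfolding topspace_lambda_space
  proof (rule inj_onI)
    fix p q assume pq: "p \<in> lambda_set X" "q \<in> lambda_set X" and eq: "?\<Phi> p = ?\<Phi> q"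
    have eq': "stone_cech_extension X f p = stone_cech_extension X f q" if "f \<in> Cs X" for f
      using fun_cong[OF eq, of f] that by (simp add: point_character_def)
    obtain g where g: "g \<in> Cs X" "stone_cech_extension X g p = 1" "stone_cech_extension X g q = 1"
      using bump pq by blast
    have "p u = q u" for u
    proof (cases "u \<in> unit_functions X")
      case True
      define G where "G r = complex_of_real (r u)" for r :: "('a \<Rightarrow> real) \<Rightarrow> real"
      define f where "f = (\<lambda>x \<in> topspace X. G (evaluation X x))"
      have G: "continuous_map (stone_cech X) euclidean G"
        using continuous_map_stone_cech_coordinate[OF True] unfolding G_def
        by (intro continuous_map_complex_of_real) (simp add: continuous_map_in_subtopology)
      then have f: "f \<in> Cb X" unfolding f_def by (rule restriction_in_Cb[OF X])
      have "stone_cech_extension X (fun_mult X f g) r = G r * stone_cech_extension X g r"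
        if "r \<in> lambda_set X" for r
        using stone_cech_extension_fun_mult[OF f Cs_subset_Cb[OF g(1)], of r]
          stone_cech_extension_restriction[OF X G, of r] sub that
        by (auto simp: f_def)
      then have "G p = G q"
        using eq'[OF fun_mult_in_Cs(2)[OF X g(1) f]] pq g by simp
      then show ?thesis by (simp add: G_def)
    next
      case False
      have "r u = undefined" if "r \<in> lambda_set X" for r
        using that sub False
        by (auto simp: stone_cech_def cube_def topspace_subtopology PiE_def extensional_def)
      from this[OF pq(1)] this[OF pq(2)] show ?thesis by simp
    qed
    then show "p = q" by blast
  qed
  show "open_map (lambda_space X) (spectrum X (Cs X)) ?\<Phi>"
    unfolding open_map_def
  proof (intro allI impI)
    fix U assume "openin (lambda_space X) U"
    then have U: "openin (stone_cech X) U" "U \<subseteq> lambda_set X"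
      by (auto simp: openin_lambda_space)
    have "\<exists>W. openin (spectrum X (Cs X)) W \<and> ?\<Phi> p \<in> W \<and> W \<subseteq> ?\<Phi> ` U" if p: "p \<in> U" for p
    proof -
      have pl: "p \<in> lambda_set X" using p U by auto
      obtain g where g: "g \<in> Cs X" "stone_cech_extension X g p = 1"
        using bump[OF pl pl] by blast
      \<comment> \<open>The function h of the algebra is nonzero at p and vanishes off U, so the characters that do not annihilate h form a neighbourhood of the image of p inside the image of U.\<close>
      have "normal_space (stone_cech X)"
        using compact_space_stone_cech Hausdorff_space_stone_cech
        by (rule compact_Hausdorff_or_regular_imp_normal_space[OF _ disjI1])
      moreover have "closedin (stone_cech X) {p}"
        using pl sub Hausdorff_space_stone_cech[of X] by (intro closedin_Hausdorff_singleton) auto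
      moreover have "closedin (stone_cech X) (topspace (stone_cech X) - U)"
        using U(1) by blast
      ultimately obtain k :: "_ \<Rightarrow> real"
        where k: "continuous_map (stone_cech X) euclideanreal k" "k ` {p} \<subseteq> {1}"
          "k ` (topspace (stone_cech X) - U) \<subseteq> {0}"
        using Urysohn_lemma_alt[of "stone_cech X" "{p}" "topspace (stone_cech X) - U" 1 0] p
        by (auto simp: disjnt_iff)
      define f where "f = (\<lambda>x \<in> topspace X. complex_of_real (k (evaluation X x)))"
      have contk: "continuous_map (stone_cech X) euclidean (\<lambda>q. complex_of_real (k q))"
        by (rule continuous_map_complex_of_real[OF k(1)])
      then have f: "f \<in> Cb X" unfolding f_def by (rule restriction_in_Cb[OF X])
      define h where "h = fun_mult X f g"
      have h: "h \<in> Cs X" unfolding h_def by (rule fun_mult_in_Cs(2)[OF X g(1) f])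
      have hq: "stone_cech_extension X h q = k q * stone_cech_extension X g q" if "q \<in> lambda_set X" for q
        using stone_cech_extension_fun_mult[OF f Cs_subset_Cb[OF g(1)], of q]
          stone_cech_extension_restriction[OF X contk, of q] sub that
        by (auto simp: f_def h_def)
      define W where "W = {\<phi> \<in> topspace (spectrum X (Cs X)). \<phi> h \<in> - {0}}"
      have "openin (spectrum X (Cs X)) W"
        unfolding W_def
        by (rule openin_continuous_map_preimage[OF continuous_map_spectrum_apply[OF h]]) (simp add: open_Compl)
      moreover have "?\<Phi> p \<in> W"
        using char[OF pl] hq[OF pl] k(2) g(2) h by (simp add: W_def top point_character_def)
      moreover have "W \<subseteq> ?\<Phi> ` U"
      proof
        fix \<phi> assume \<phi>: "\<phi> \<in> W"
        then obtain q where q: "q \<in> lambda_set X" "\<phi> = ?\<Phi> q"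
          using onto by (auto simp: W_def topspace_lambda_space)
        then have "k q \<noteq> 0" using \<phi> hq[OF q(1)] h by (auto simp: W_def point_character_def)
        then have "q \<in> U" using k(3) q(1) sub by blast
        then show "\<phi> \<in> ?\<Phi> ` U" using q by blast
      qed
      ultimately show ?thesis by blast
    qed
    then show "openin (spectrum X (Cs X)) (?\<Phi> ` U)"
      by (subst openin_subopen) blast
  qed
qed

section \<open>Non-normality of the subspace lambda\<close>

lemma closure_of_evaluation_image:
  assumes X: "metrizable_space X" and S: "S \<subseteq> topspace X" and x: "x \<in> topspace X"
    and cl: "evaluation X x \<in> stone_cech X closure_of (evaluation X ` S)"
  shows "x \<in> X closure_of S"
proof -
  note hom = homeomorphic_map_evaluation[OF X]
  have "evaluation X x \<in> subtopology (stone_cech X) (evaluation X ` topspace X) closure_of (evaluation X ` S)"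
    using cl x S by (simp add: closure_of_subtopology Int_absorb1 image_mono)
  then have "evaluation X x \<in> evaluation X ` (X closure_of S)"
    using homeomorphic_map_closure_of[OF hom S] by simp
  then show ?thesis
    using homeomorphic_imp_injective_map[OF hom] x closure_of_subset_topspace[of X S]
    by (auto dest: inj_onD)
qed

text \<open>A Urysohn function for \<open>P\<close> and \<open>Q\<close> is one of the coordinates of the cube, and each coordinate
is constant on the closure of a set on which it is constant.\<close>

lemma disjoint_closures_stone_cech:
  assumes X: "metrizable_space X" and PQ: "closedin X P" "closedin X Q" "P \<inter> Q = {}"
  shows "stone_cech X closure_of (evaluation X ` P) \<inter> stone_cech X closure_of (evaluation X ` Q) = {}"
proof -
  obtain f where f: "continuous_map X (top_of_set {0..1::real}) f" "f ` P \<subseteq> {0}" "f ` Q \<subseteq> {1}"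
    using Urysohn_lemma[OF metrizable_imp_normal_space[OF X] PQ(1,2), of 0 1] PQ(3) by (auto simp: disjnt_def)
  define u where "u = restrict f (topspace X)"
  have "continuous_map X euclideanreal u"
    using f(1) by (auto simp: u_def continuous_map_in_subtopology intro: continuous_map_eq[of _ _ f])
  then have u: "u \<in> unit_functions X"
    using f(1) by (auto simp: unit_functions_def u_def continuous_map_in_subtopology)
  have cont: "continuous_map (stone_cech X) euclideanreal (\<lambda>p. p u)"
    using continuous_map_stone_cech_coordinate[OF u] by (simp add: continuous_map_in_subtopology)
  have "p u = c" if "p \<in> stone_cech X closure_of (evaluation X ` R)" "f ` R \<subseteq> {c}" "R \<subseteq> topspace X" for p R c
  proof (rule forall_in_closure_of_eq[OF that(1), of euclideanreal "\<lambda>p. p u" "\<lambda>_. c"])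
    fix q assume "q \<in> evaluation X ` R"
    then obtain x where "x \<in> R" "q = evaluation X x" by blast
    moreover from this have "u x = c" using that(2,3) by (auto simp: u_def)
    ultimately show "q u = c" using u by (simp add: evaluation_def)
  qed (use cont in auto)
  from this[of _ P 0] this[of _ Q 1] show ?thesis
    using f(2,3) closedin_subset[OF PQ(1)] closedin_subset[OF PQ(2)] by (force simp: disjoint_iff)
qed

text \<open>The points of an uncountable set whose mutual distances are bounded away from 0 satisfy the
hypotheses of the criterion: a basic open set of \<open>\<lambda>X\<close> meets it only within a separable set,
and disjoint subsets of it are disjoint closed subsets of \<open>X\<close>.\<close>

lemma not_normal_space_lambda:
  assumes X: "metrizable_space X" and loc: "locally_separable_space X" and nsep: "\<not> separable_space X"
  shows "\<not> normal_space (lambda_space X)"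
proof -
  obtain D where D: "D \<subseteq> topspace X" "uncountable D" "\<And>S. S \<subseteq> D \<Longrightarrow> closedin X S"
    "\<And>S. separable_in X S \<Longrightarrow> countable (D \<inter> S)"
    using uncountable_strongly_discrete_subset[OF X nsep] by blast
  show ?thesis
  proof (rule not_normal_if_uncountable_strongly_discrete[where D = D and j = "evaluation X"])
    show "Hausdorff_space (lambda_space X)"
      unfolding lambda_space_def by (intro Hausdorff_space_subtopology Hausdorff_space_stone_cech)
    show "countably_compact_space (lambda_space X)"
      by (rule countably_compact_space_lambda[OF X loc])
    show "uncountable D" by (rule D)
    show "inj_on (evaluation X) D"
      by (rule inj_on_subset[OF homeomorphic_imp_injective_map[OF homeomorphic_map_evaluation[OF X]] D(1)])
    show "evaluation X ` D \<subseteq> topspace (lambda_space X)"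
      unfolding topspace_lambda_space
    proof clarify
      fix d assume "d \<in> D"
      then have d: "{d} \<subseteq> topspace X" using D(1) by auto
      then have "separable_in X {d}"
        unfolding separable_in_iff[OF d] by (intro exI[of _ "{d}"] conjI closure_of_subset d) auto
      then have "stone_cech X closure_of (evaluation X ` {d}) \<subseteq> lambda_set X"
        by (rule closure_subset_lambda_set[OF X loc d])
      moreover have "evaluation X d \<in> stone_cech X closure_of (evaluation X ` {d})"
        using closure_of_subset[of "evaluation X ` {d}" "stone_cech X"] evaluation_in_stone_cech[of d X] d
        by simp
      ultimately show "evaluation X d \<in> lambda_set X" by blast
    qed
    show "\<exists>U. openin (lambda_space X) U \<and> p \<in> U \<and> countable {d \<in> D. evaluation X d \<in> U}"
      if "p \<in> topspace (lambda_space X)" for p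
    proof -
      have "p \<in> lambda_set X" using that by (simp add: topspace_lambda_space)
      then obtain S where S: "S \<subseteq> topspace X" "separable_in X S"
        "p \<in> stone_cech X interior_of (stone_cech X closure_of (evaluation X ` S))"
        by (rule lambda_set_closure)
      let ?U = "stone_cech X interior_of (stone_cech X closure_of (evaluation X ` S))"
      have U: "?U \<subseteq> stone_cech X closure_of (evaluation X ` S)" by (rule interior_of_subset)
      then have openU: "openin (lambda_space X) ?U"
        using closure_subset_lambda_set[OF X loc S(1,2)] by (simp add: openin_lambda_space)
      have trace: "{d \<in> D. evaluation X d \<in> ?U} \<subseteq> D \<inter> X closure_of S"
      proof
        fix d assume "d \<in> {d \<in> D. evaluation X d \<in> ?U}"
        then have "d \<in> D" "evaluation X d \<in> ?U" by simp_all
        then show "d \<in> D \<inter> X closure_of S"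
          using closure_of_evaluation_image[OF X S(1), of d] U D(1) by blast
      qed
      have "countable {d \<in> D. evaluation X d \<in> ?U}"
        by (rule countable_subset[OF trace D(4)[OF separable_in_subset_closure[OF X S(2) order_refl]]])
      then show ?thesis using S(3) openU by blast
    qed
    show "lambda_space X closure_of (evaluation X ` P) \<inter> lambda_space X closure_of (evaluation X ` Q) = {}"
      if "P \<subseteq> D" "Q \<subseteq> D" "P \<inter> Q = {}" for P Q
    proof -
      have "lambda_space X closure_of (evaluation X ` R) \<subseteq> stone_cech X closure_of (evaluation X ` R)" for R
        unfolding lambda_space_def by (rule closure_of_subtopology_subset)
      then show ?thesis
        using disjoint_closures_stone_cech[OF X D(3)[OF that(1)] D(3)[OF that(2)] that(3)] by blast
    qed
  qed
qed

theorem theorem4p1: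
  fixes X :: "'a topology"
  assumes "metrizable_space X"
    and "locally_separable_space X"
    and "\<not> separable_space X"
  shows "spectrum X (Cs X) homeomorphic_space lambda_space X
    \<and> locally_compact_space (spectrum X (Cs X))
    \<and> countably_compact_space (spectrum X (Cs X))
    \<and> \<not> normal_space (spectrum X (Cs X))"
proof -
  have ne: "topspace X \<noteq> {}"
    using assms(3) by (auto simp: separable_space_def)
  have hom: "homeomorphic_map (lambda_space X) (spectrum X (Cs X)) (point_character X)"
    by (rule homeomorphic_map_point_character[OF assms(1,2) ne])
  then have hs: "spectrum X (Cs X) homeomorphic_space lambda_space X"
    using homeomorphic_map_imp_homeomorphic_space homeomorphic_space_sym by blast
  have "countably_compact_space (spectrum X (Cs X))"
    by (rule countably_compact_space_continuous_image[OF
          countably_compact_space_lambda[OF assms(1,2)] homeomorphic_imp_continuous_map[OF hom]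
          homeomorphic_imp_surjective_map[OF hom]])
  then show ?thesis
    using hs homeomorphic_locally_compact_space[OF hs] homeomorphic_normal_space[OF hs]
      locally_compact_space_lambda not_normal_space_lambda[OF assms] by blast
qed

end
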